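(* Let $(X,\mu)$ be a non-atomic probability space equipped with a tree $\mathcal{T}$, with associated dyadic maximal operator $\mathcal{M}_{\mathcal{T}}$. Let $p>1$, $0<f^p\le F$ (with $f>0$) and $L\ge f$, and define $$B_p(f,F,L)=\sup\left\{\int_X\max(\mathcal{M}_{\mathcal{T}}\phi,L)^p\,d\mu:\ \phi\ge0\text{ measurable on }X,\ \int_X\phi\,d\mu=f,\ \int_X\phi^p\,d\mu=F\right\}.$$ Then $$B_p(f,F,L)=\begin{cases}F\,\omega_p\left(\dfrac{pL^{p-1}f-(p-1)L^p}{F}\right)^p, & \text{if } L<\dfrac{p}{p-1}f,\\[2ex] L^p+\left(\dfrac{p}{p-1}\right)^p(F-f^p), & \text{if } L\ge\dfrac{p}{p-1}f.\end{cases}$$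
   Context: Tree: a set $\mathcal{T}$ of measurable subsets of $X$ is called a tree if: (i) $X\in\mathcal{T}$ and $\mu(I)>0$ for every $I\in\mathcal{T}$; (ii) to every $I\in\mathcal{T}$ there corresponds a finite or countable subset $C(I)\subseteq\mathcal{T}$ containing at least two elements such that the elements of $C(I)$ are pairwise disjoint subsets of $I$ and $I=\bigcup C(I)$; (iii) $\mathcal{T}=\bigcup_{m\ge0}\mathcal{T}_{(m)}$, where $\mathcal{T}_{(0)}=\{X\}$ and $\mathcal{T}_{(m+1)}=\bigcup_{I\in\mathcal{T}_{(m)}}C(I)$; (iv) $\lim_{m\to\infty}\sup_{I\in\mathcal{T}_{(m)}}\mu(I)=0$. Dyadic maximal operator: for $\phi\in L^1(X,\mu)$, $\mathcal{M}_{\mathcal{T}}\phi(x)=\sup\left\{\frac{1}{\mu(I)}\int_I|\phi|\,d\mu:\ x\in I\in\mathcal{T}\right\}$. The function $\omega_p:[0,1]\to\left[1,\frac{p}{p-1}\right]$ is the inverse of the strictly decreasing bijection $H_p:\left[1,\frac{p}{p-1}\right]\to[0,1]$, $H_p(z)=-(p-1)z^p+pz^{p-1}$. *)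

theory Defs
  imports "HOL-Probability.Probability"
begin

definition nonatomic :: "'a measure \<Rightarrow> bool" where
  "nonatomic M \<longleftrightarrow>
     (\<forall>A\<in>sets M. 0 < emeasure M A \<longrightarrow>
        (\<exists>B\<in>sets M. B \<subseteq> A \<and> 0 < emeasure M B \<and> emeasure M B < emeasure M A))"

primrec tree_level :: "'a set \<Rightarrow> ('a set \<Rightarrow> 'a set set) \<Rightarrow> nat \<Rightarrow> 'a set set" where
  "tree_level X C 0 = {X}"
| "tree_level X C (Suc m) = (\<Union>I\<in>tree_level X C m. C I)"

definition is_tree :: "'a measure \<Rightarrow> 'a set set \<Rightarrow> bool" where
  "is_tree M T \<longleftrightarrow>
     T \<subseteq> sets M \<and>
     space M \<in> T \<and>
     (\<forall>I\<in>T. 0 < emeasure M I) \<and>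
     (\<exists>C :: 'a set \<Rightarrow> 'a set set.
        (\<forall>I\<in>T. C I \<subseteq> T \<and> countable (C I) \<and>
           (\<exists>J\<in>C I. \<exists>K\<in>C I. J \<noteq> K) \<and>
           disjoint (C I) \<and> (\<forall>J\<in>C I. J \<subseteq> I) \<and> I = \<Union>(C I)) \<and>
        T = (\<Union>m. tree_level (space M) C m) \<and>
        (\<lambda>m. SUP I\<in>tree_level (space M) C m. emeasure M I) \<longlonglongrightarrow> 0)"

text \<open>Averages are taken in \<open>ennreal\<close>, so that the supremum is the true one even at points
  where it is infinite.\<close>

definition dyadic_maximal ::
  "'a measure \<Rightarrow> 'a set set \<Rightarrow> ('a \<Rightarrow> real) \<Rightarrow> 'a \<Rightarrow> ennreal" where
  "dyadic_maximal M T \<phi> x =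
     (SUP I\<in>{I\<in>T. x \<in> I}. (\<integral>\<^sup>+y\<in>I. ennreal \<bar>\<phi> y\<bar> \<partial>M) / emeasure M I)"

text \<open>The extension of the power function to \<open>[0, \<infinity>]\<close>; only used for exponents \<open>p > 0\<close>.\<close>

definition ennpowr :: "ennreal \<Rightarrow> real \<Rightarrow> ennreal" where
  "ennpowr x p = (if x = \<infinity> then \<infinity> else ennreal (enn2real x powr p))"

definition H_fun :: "real \<Rightarrow> real \<Rightarrow> real" where
  "H_fun p z = - (p - 1) * z powr p + p * z powr (p - 1)"

definition omega_fun :: "real \<Rightarrow> real \<Rightarrow> real" where
  "omega_fun p = inv_into {1..p / (p - 1)} (H_fun p)"

definition bellman_admissible ::
  "'a measure \<Rightarrow> real \<Rightarrow> real \<Rightarrow> real \<Rightarrow> ('a \<Rightarrow> real) set" where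
  "bellman_admissible M p f F =
     {\<phi>. \<phi> \<in> borel_measurable M \<and> (\<forall>x\<in>space M. 0 \<le> \<phi> x) \<and>
          (\<integral>\<^sup>+x. ennreal (\<phi> x) \<partial>M) = ennreal f \<and>
          (\<integral>\<^sup>+x. ennreal (\<phi> x powr p) \<partial>M) = ennreal F}"

definition bellman ::
  "'a measure \<Rightarrow> 'a set set \<Rightarrow> real \<Rightarrow> real \<Rightarrow> real \<Rightarrow> real \<Rightarrow> ennreal" where
  "bellman M T p f F L =
     (SUP \<phi>\<in>bellman_admissible M p f F.
        \<integral>\<^sup>+x. ennpowr (max (dyadic_maximal M T \<phi> x) (ennreal L)) p \<partial>M)"

end

theory Submission
  imports Defs
begin

text \<open>
  Upper bound: the set where the maximal function exceeds \<open>l\<close> is a disjoint union of maximal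
  cells, so \<open>l \<cdot> \<mu>(l < M\<phi>)\<close> is at most the integral of \<open>\<phi>\<close> over it. Integrating against
  \<open>p l\<^sup>p\<^sup>-\<^sup>1 dl\<close> over \<open>l > L\<close>, with \<open>m = max (M\<phi>) L\<close> truncated so that everything is finite, gives
  \<open>\<integral>m\<^sup>p - L\<^sup>p \<le> p/(p-1) \<integral>\<phi>(m\<^sup>p\<^sup>-\<^sup>1 - L\<^sup>p\<^sup>-\<^sup>1)\<close>, and Young's inequality, an equality where
  \<open>m = z\<phi>\<close>, yields the claim: with \<open>z = \<omega>\<^sub>p(\<dots>)\<close> everywhere for small \<open>L\<close>; for large \<open>L\<close> with
  \<open>z = p/(p-1)\<close> on \<open>{m > L}\<close>, using the tangent of \<open>x\<^sup>p\<close> at \<open>f\<close> elsewhere.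

  Lower bound: nested unions of disjoint cells \<open>S\<^sub>0 \<supseteq> S\<^sub>1 \<supseteq> \<dots>\<close> of prescribed relative measure carry a
  function that is constant on each \<open>S\<^sub>k - S\<^sub>k\<^sub>+\<^sub>1\<close>. From \<open>S\<^sub>2\<close> on, a set of measure \<open>\<kappa>\<close>, the measures
  and values are geometric, chosen so that cells of \<open>S\<^sub>2\<close> have average \<open>L\<close> and the maximal function
  is at least \<open>a\<phi>\<close> there; the first two layers only adjust \<open>\<integral>\<phi>\<close> and \<open>\<integral>\<phi>\<^sup>p\<close> to \<open>f\<close> and \<open>F\<close>.
\<close>

section \<open>Cells of the tree\<close>

lemma emeasure_Union_cmult_le:
  assumes "countable \<F>" "disjoint \<F>" "\<F> \<subseteq> sets M" "sets N = sets M"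
    and le: "\<And>I. I \<in> \<F> \<Longrightarrow> c * emeasure M I \<le> emeasure N I"
  shows "c * emeasure M (\<Union>\<F>) \<le> emeasure N (\<Union>\<F>)"
proof -
  have disj: "disjoint_family_on (\<lambda>I. I) \<F>"
    using assms(2) by (auto simp: disjoint_family_on_def disjoint_def)
  have M: "emeasure M (\<Union>\<F>) = (\<integral>\<^sup>+I. emeasure M I \<partial>count_space \<F>)"
    using emeasure_UN_countable[of \<F> "\<lambda>I. I" M] assms disj by auto
  have N: "emeasure N (\<Union>\<F>) = (\<integral>\<^sup>+I. emeasure N I \<partial>count_space \<F>)"
    using emeasure_UN_countable[of \<F> "\<lambda>I. I" N] assms disj by auto
  have "c * emeasure M (\<Union>\<F>) = (\<integral>\<^sup>+I. c * emeasure M I \<partial>count_space \<F>)"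
    unfolding M by (simp add: nn_integral_cmult)
  also have "\<dots> \<le> emeasure N (\<Union>\<F>)"
    unfolding N by (intro nn_integral_mono) (auto intro: le)
  finally show ?thesis .
qed

lemma measure_Union_Int_eq_cmult:
  assumes "finite_measure M" "countable \<F>" "disjoint \<F>" "\<F> \<subseteq> sets M" "S \<in> sets M" "0 \<le> c"
    and eq: "\<And>I. I \<in> \<F> \<Longrightarrow> measure M (I \<inter> S) = c * measure M I"
  shows "measure M (\<Union>\<F> \<inter> S) = c * measure M (\<Union>\<F>)"
proof -
  interpret finite_measure M by fact
  have disj: "disjoint_family_on (\<lambda>I. I) \<F>" "disjoint_family_on (\<lambda>I. I \<inter> S) \<F>"
    using assms(3) by (auto simp: disjoint_family_on_def disjoint_def)
  have "emeasure M (\<Union>\<F> \<inter> S) = emeasure M (\<Union>I\<in>\<F>. I \<inter> S)"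
    by (rule arg_cong[where f = "emeasure M"]) blast
  also have "\<dots> = (\<integral>\<^sup>+I. emeasure M (I \<inter> S) \<partial>count_space \<F>)"
    using assms by (intro emeasure_UN_countable disj) auto
  also have "\<dots> = (\<integral>\<^sup>+I. ennreal c * emeasure M I \<partial>count_space \<F>)"
    using eq \<open>0 \<le> c\<close> by (intro nn_integral_cong) (auto simp: emeasure_eq_measure ennreal_mult)
  also have "\<dots> = ennreal c * (\<integral>\<^sup>+I. emeasure M I \<partial>count_space \<F>)"
    by (simp add: nn_integral_cmult)
  also have "(\<integral>\<^sup>+I. emeasure M I \<partial>count_space \<F>) = emeasure M (\<Union>I\<in>\<F>. I)"
    using assms by (intro emeasure_UN_countable[symmetric] disj) auto
  finally show ?thesis
    using \<open>0 \<le> c\<close> by (simp add: emeasure_eq_measure ennreal_mult[symmetric])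
qed

text \<open>\<open>is_tree\<close> only asserts that some children map exists; fixing
  \<open>C\<close> as a parameter gives all lemmas the same levels.\<close>

locale tree_prob_space = prob_space M for M :: "'a measure" +
  fixes T :: "'a set set" and C :: "'a set \<Rightarrow> 'a set set"
  assumes T_sets: "T \<subseteq> sets M"
    and space_in_T: "space M \<in> T"
    and T_pos: "I \<in> T \<Longrightarrow> 0 < emeasure M I"
    and children_T: "I \<in> T \<Longrightarrow> C I \<subseteq> T"
    and countable_children: "I \<in> T \<Longrightarrow> countable (C I)"
    and disjoint_children: "I \<in> T \<Longrightarrow> disjoint (C I)"
    and Union_children: "I \<in> T \<Longrightarrow> \<Union>(C I) = I"
    and T_levels: "T = (\<Union>m. tree_level (space M) C m)"
    and mesh: "(\<lambda>m. SUP I\<in>tree_level (space M) C m. emeasure M I) \<longlonglongrightarrow> 0"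
begin

abbreviation level :: "nat \<Rightarrow> 'a set set" where
  "level \<equiv> tree_level (space M) C"

lemma level_subset_T: "level n \<subseteq> T"
  by (subst T_levels) auto

lemma level_in_T: "I \<in> level n \<Longrightarrow> I \<in> T"
  using level_subset_T[of n] by auto

lemma in_some_level: "I \<in> T \<Longrightarrow> \<exists>n. I \<in> level n"
  by (subst (asm) T_levels) blast

lemma child_subset: "I \<in> T \<Longrightarrow> J \<in> C I \<Longrightarrow> J \<subseteq> I"
  using Union_children[of I] by auto

lemma in_sets: "I \<in> T \<Longrightarrow> I \<in> sets M"
  using T_sets by auto

lemma measure_T_pos: "I \<in> T \<Longrightarrow> 0 < measure M I"
  using T_pos[of I] by (simp add: emeasure_eq_measure)

lemma T_nonempty: "I \<in> T \<Longrightarrow> I \<noteq> {}"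
  using T_pos[of I] by auto

lemma countable_level: "countable (level n)"
proof (induction n)
  case (Suc n)
  then show ?case
    by (auto intro!: countable_UN countable_children dest: level_in_T)
qed auto

lemma countable_T: "countable T"
  by (subst T_levels) (intro countable_UN countable_level countableI_type)

text \<open>For \<open>k = 0\<close> this is disjointness within one level, which comes from
  disjoint siblings or from disjoint parents. Each further level follows because a cell lies in its
  parent, which then meets \<open>I\<close> as well.\<close>

lemma level_disjoint_or_nested:
  assumes "I \<in> level n" "J \<in> level (n + k)" "I \<inter> J \<noteq> {}"
  shows "J \<subseteq> I"
  using assms
proof (induction k arbitrary: J)
  case 0
  have "disjoint (level n)" for n
  proof (induction n)
    case (Suc n)
    show ?case
    proof (rule disjointI)
      fix A B assume "A \<in> level (Suc n)" "B \<in> level (Suc n)" "A \<noteq> B"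
      then obtain A' B' where AB: "A' \<in> level n" "B' \<in> level n" "A \<in> C A'" "B \<in> C B'"
        by auto
      then have sub: "A \<subseteq> A'" "B \<subseteq> B'"
        by (auto dest: level_in_T intro: child_subset[THEN subsetD])
      show "A \<inter> B = {}"
      proof (cases "A' = B'")
        case True
        then show ?thesis
          using AB \<open>A \<noteq> B\<close> disjointD[OF disjoint_children[OF level_in_T[OF AB(1)]], of A B]
          by simp
      next
        case False
        then show ?thesis
          using sub AB disjointD[OF Suc, of A' B'] by auto
      qed
    qed
  qed auto
  then show ?case
    using 0 by (auto simp: disjoint_def)
next
  case (Suc k)
  then obtain J' where J': "J' \<in> level (n + k)" "J \<in> C J'"
    by auto
  then have "J \<subseteq> J'"
    using child_subset level_in_T by simp
  then show ?case
    using Suc.IH[OF Suc.prems(1) J'(1)] Suc.prems(3) by auto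
qed

lemma T_disjoint_or_nested:
  assumes "I \<in> T" "J \<in> T" "I \<inter> J \<noteq> {}"
  shows "I \<subseteq> J \<or> J \<subseteq> I"
proof -
  obtain n m where nm: "I \<in> level n" "J \<in> level m"
    using assms in_some_level by blast
  show ?thesis
  proof (cases "n \<le> m")
    case True
    then show ?thesis
      using level_disjoint_or_nested[of I n J "m - n"] nm assms by auto
  next
    case False
    then show ?thesis
      using level_disjoint_or_nested[of J m I "n - m"] nm assms by auto
  qed
qed

text \<open>A cell in \<open>\<B>\<close> has only finitely many ancestors, so one of least level among those in
  \<open>\<B>\<close> is maximal.\<close>

lemma exists_maximal_cells:
  assumes "\<B> \<subseteq> T"
  obtains \<F> where "\<F> \<subseteq> \<B>" "disjoint \<F>" "\<Union>\<F> = \<Union>\<B>"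
proof
  let ?F = "{J \<in> \<B>. \<forall>K\<in>\<B>. J \<subseteq> K \<longrightarrow> K = J}"
  show "?F \<subseteq> \<B>" by auto
  show "disjoint ?F"
  proof (rule disjointI)
    fix K K' assume K: "K \<in> ?F" "K' \<in> ?F" "K \<noteq> K'"
    with assms have "K \<in> T" "K' \<in> T" by auto
    with K show "K \<inter> K' = {}"
      using T_disjoint_or_nested[of K K'] by blast
  qed
  have "\<exists>J\<in>?F. I \<subseteq> J" if I: "I \<in> \<B>" for I
  proof -
    define P where "P n \<longleftrightarrow> (\<exists>J\<in>level n \<inter> \<B>. I \<subseteq> J)" for n
    have "\<exists>n. P n"
      using I assms in_some_level[of I] by (auto simp: P_def)
    then have "P (LEAST n. P n)" by (rule LeastI_ex)
    then obtain J where J: "J \<in> level (LEAST n. P n)" "J \<in> \<B>" "I \<subseteq> J"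
      by (auto simp: P_def)
    have "K = J" if K: "K \<in> \<B>" "J \<subseteq> K" for K
    proof -
      obtain k where k: "K \<in> level k"
        using K assms in_some_level by blast
      have "P k"
        using k K J by (auto simp: P_def)
      then have "(LEAST n. P n) \<le> k" by (rule Least_le)
      moreover have "J \<inter> K \<noteq> {}"
        using K(2) J(2) assms T_nonempty[of J] by blast
      ultimately have "K \<subseteq> J"
        using level_disjoint_or_nested[OF J(1), of K "k - (LEAST n. P n)"] k by simp
      with K show ?thesis by auto
    qed
    with J show ?thesis by blast
  qed
  then show "\<Union>?F = \<Union>\<B>" by blast
qed

text \<open>Greedy step towards a family of measure \<open>r\<close>: the children are enumerated
  and accepted while their total stays at most \<open>r\<close>. The first child that would
  overshoot becomes \<open>J'\<close>. Its measure exceeds the remainder \<open>r'\<close>, so the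
  step can be repeated inside it.\<close>

lemma children_split:
  assumes J: "J \<in> T" and r: "0 \<le> r" "r < measure M J"
  obtains \<A> J' r' where "\<A> \<subseteq> C J" "J' \<in> C J" "J' \<notin> \<A>" "0 \<le> r'" "r' < measure M J'"
    "measure M (\<Union>\<A>) = r - r'"
proof -
  define idx where "idx = to_nat_on (C J)"
  have inj: "inj_on idx (C J)"
    unfolding idx_def using countable_children[OF J] by (rule inj_on_to_nat_on)
  define A where "A n = {K \<in> C J. idx K < n}" for n
  have A_sets: "K \<in> sets M" if "K \<in> A n" for K n
    using that children_T[OF J] T_sets by (auto simp: A_def)
  have meas: "\<Union>(A n) \<in> sets M" for n
    using countable_children[OF J] A_sets
    by (intro sets.countable_Union countable_subset[of "A n" "C J"]) (auto simp: A_def)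
  have "(\<Union>n. \<Union>(A n)) = J"
    using Union_children[OF J] unfolding A_def by fastforce
  moreover have "incseq (\<lambda>n. \<Union>(A n))"
    by (intro monoI) (fastforce simp: A_def)
  ultimately have "(\<lambda>n. measure M (\<Union>(A n))) \<longlonglongrightarrow> measure M J"
    using finite_Lim_measure_incseq[of "\<lambda>n. \<Union>(A n)"] meas by (simp add: image_subset_iff)
  then have "\<forall>\<^sub>F n in sequentially. r < measure M (\<Union>(A n))"
    using r(2) by (rule order_tendstoD)
  then have "\<exists>n. r < measure M (\<Union>(A n))"
    by (rule eventually_happens'[rotated]) simp
  then have L: "r < measure M (\<Union>(A (LEAST n. r < measure M (\<Union>(A n)))))"
    by (rule LeastI_ex)
  have "(LEAST n. r < measure M (\<Union>(A n))) \<noteq> 0"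
  proof
    assume "(LEAST n. r < measure M (\<Union>(A n))) = 0"
    with L r show False by (auto simp: A_def)
  qed
  then obtain m where m: "(LEAST n. r < measure M (\<Union>(A n))) = Suc m"
    using not0_implies_Suc by blast
  have le: "measure M (\<Union>(A m)) \<le> r"
    using not_less_Least[of m "\<lambda>n. r < measure M (\<Union>(A n))"] m by auto
  have gt: "r < measure M (\<Union>(A (Suc m)))"
    using L m by simp
  \<comment> \<open>The enumeration need not hit every index, since \<open>C J\<close> may be
    finite. Without a child of index \<open>m\<close>, however, the total could not cross
    \<open>r\<close> between \<open>m\<close> and \<open>Suc m\<close>.\<close>
  have "\<exists>K\<in>C J. idx K = m"
  proof (rule ccontr)
    assume "\<not> ?thesis"
    then have "A (Suc m) = A m"
      by (auto simp: A_def less_Suc_eq)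
    with le gt show False by simp
  qed
  then obtain K where K: "K \<in> C J" "idx K = m" by auto
  have Kn: "K \<notin> A m" using K by (auto simp: A_def)
  have AS: "A (Suc m) = insert K (A m)"
    using K inj by (auto simp: A_def less_Suc_eq inj_on_def)
  have "K \<inter> \<Union>(A m) = {}"
    using disjointD[OF disjoint_children[OF J] K(1)] Kn by (auto simp: A_def)
  then have "measure M (\<Union>(A (Suc m))) = measure M K + measure M (\<Union>(A m))"
    unfolding AS using meas K children_T[OF J] T_sets
    by (simp add: finite_measure_Union subset_iff)
  then show thesis
    using le gt K Kn by (intro that[of "A m" K "r - measure M (\<Union>(A m))"]) (auto simp: A_def)
qed

text \<open>Iterating \<open>children_split\<close> gives a descending chain of cells
  \<open>J n\<close>, accepted families \<open>A n\<close> inside \<open>J n\<close> but outside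
  \<open>J (Suc n)\<close>, and remainders \<open>\<rho> n\<close> below the measure of
  \<open>J n\<close>. The mesh condition forces the remainders to 0, so the accepted measures
  telescope to exactly \<open>r\<close>.\<close>

lemma exists_subfamily_measure:
  assumes I: "I \<in> T" and r: "0 < r" "r \<le> measure M I"
  obtains \<F> where "\<F> \<subseteq> T" "disjoint \<F>" "\<Union>\<F> \<subseteq> I" "measure M (\<Union>\<F>) = r"
proof (cases "r = measure M I")
  case True
  with I show ?thesis by (intro that[of "{I}"]) auto
next
  case False
  with r have r: "0 \<le> r" "r < measure M I" by auto
  obtain n0 where n0: "I \<in> level n0"
    using I in_some_level by blast
  \<comment> \<open>A state is a cell together with the measure still to be collected inside it. The
    clause for \<open>n = 0\<close> pins the start of the chain, which
    \<open>dependent_nat_choice\<close> would leave open.\<close>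
  let ?P = "\<lambda>n (J, \<rho>). J \<in> level (n0 + n) \<and> 0 \<le> \<rho> \<and> \<rho> < measure M J \<and> (n = 0 \<longrightarrow> J = I \<and> \<rho> = r)"
  let ?Q = "\<lambda>n (J, \<rho>) (J', \<rho>'). \<exists>\<A>. \<A> \<subseteq> C J \<and> J' \<in> C J \<and> J' \<notin> \<A> \<and> measure M (\<Union>\<A>) = \<rho> - \<rho>'"
  have "\<exists>s. \<forall>n. ?P n (s n) \<and> ?Q n (s n) (s (Suc n))"
  proof (rule dependent_nat_choice)
    show "\<exists>x. ?P 0 x"
      using n0 r by auto
  next
    fix x n assume "?P n x"
    then obtain J \<rho> where x: "x = (J, \<rho>)" "J \<in> level (n0 + n)" "0 \<le> \<rho>" "\<rho> < measure M J"
      by (cases x) auto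
    then obtain \<A> J' r' where "\<A> \<subseteq> C J" "J' \<in> C J" "J' \<notin> \<A>" "0 \<le> r'" "r' < measure M J'"
        "measure M (\<Union>\<A>) = \<rho> - r'"
      using children_split[of J \<rho>] level_subset_T by blast
    then show "\<exists>y. ?P (Suc n) y \<and> ?Q n x y"
      using x by (intro exI[of _ "(J', r')"]) auto
  qed
  then obtain s where "\<forall>n. ?P n (s n) \<and> ?Q n (s n) (s (Suc n))" ..
  then have s: "?P n (s n)" "?Q n (s n) (s (Suc n))" for n
    by simp_all
  define J \<rho> where "J n = fst (s n)" and "\<rho> n = snd (s n)" for n
  have P: "J n \<in> level (n0 + n)" "0 \<le> \<rho> n" "\<rho> n < measure M (J n)" for n
    using s(1)[of n] by (auto simp: J_def \<rho>_def split: prod.splits)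
  have P0: "J 0 = I" "\<rho> 0 = r"
    using s(1)[of 0] by (auto simp: J_def \<rho>_def split: prod.splits)
  have "\<exists>\<A>. \<A> \<subseteq> C (J n) \<and> J (Suc n) \<in> C (J n) \<and> J (Suc n) \<notin> \<A> \<and> measure M (\<Union>\<A>) = \<rho> n - \<rho> (Suc n)" for n
    using s(2)[of n] by (auto simp: J_def \<rho>_def split: prod.splits)
  then obtain A where A: "\<And>n. A n \<subseteq> C (J n)" "\<And>n. J (Suc n) \<in> C (J n)" "\<And>n. J (Suc n) \<notin> A n"
      "\<And>n. measure M (\<Union>(A n)) = \<rho> n - \<rho> (Suc n)"
    by metis
  have JT: "J n \<in> T" for n
    using P(1) level_subset_T by blast
  have AJ: "\<Union>(A n) \<subseteq> J n" for n
    using A(1)[of n] Union_children[OF JT[of n]] by blast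
  have AJS: "\<Union>(A n) \<inter> J (Suc n) = {}" for n
    using disjointD[OF disjoint_children[OF JT[of n]] A(2)] A(1,3)[of n] by blast
  have "J (Suc n) \<subseteq> J n" for n
    using A(2)[of n] Union_children[OF JT[of n]] by blast
  then have dec: "J m \<subseteq> J n" if "n \<le> m" for n m
    using that by (rule lift_Suc_antimono_le)
  \<comment> \<open>The later family lies in \<open>J m\<close>, hence in \<open>J (Suc n)\<close>,
    which the earlier family avoids.\<close>
  have disj_lt: "\<Union>(A n) \<inter> \<Union>(A m) = {}" if "n < m" for n m
    using AJ[of m] AJS[of n] dec[of "Suc n" m] that by auto
  have AT: "A n \<subseteq> T" for n
    using A(1) children_T JT by blast
  have "countable (A n)" for n
    using AT countable_T countable_subset by blast
  then have meas: "\<Union>(A n) \<in> sets M" for n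
    using AT T_sets by (intro sets.countable_Union) blast+
  have disjfam: "disjoint_family (\<lambda>n. \<Union>(A n))"
    unfolding disjoint_family_on_def
  proof (intro ballI impI)
    fix n m :: nat assume "n \<noteq> m"
    then show "\<Union>(A n) \<inter> \<Union>(A m) = {}"
      using disj_lt[of n m] disj_lt[of m n] by (cases n m rule: linorder_cases) (simp_all add: Int_commute)
  qed
  have "(\<lambda>n. ennreal (\<rho> n)) \<longlonglongrightarrow> 0"
  proof (rule tendsto_sandwich[OF _ _ tendsto_const])
    show "(\<lambda>n. SUP I\<in>level (n0 + n). emeasure M I) \<longlonglongrightarrow> 0"
      using LIMSEQ_ignore_initial_segment[OF mesh, of n0] by (simp add: add.commute)
    show "\<forall>\<^sub>F n in sequentially. ennreal (\<rho> n) \<le> (SUP I\<in>level (n0 + n). emeasure M I)"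
    proof (intro always_eventually allI)
      fix n
      have "ennreal (\<rho> n) \<le> emeasure M (J n)"
        using P(3)[of n] by (simp add: emeasure_eq_measure)
      also have "\<dots> \<le> (SUP I\<in>level (n0 + n). emeasure M I)"
        by (intro SUP_upper P)
      finally show "ennreal (\<rho> n) \<le> (SUP I\<in>level (n0 + n). emeasure M I)" .
    qed
  qed simp
  then have \<rho>0: "\<rho> \<longlonglongrightarrow> 0"
    using P(2) by (simp add: ennreal_tendsto_0_iff)
  have "(\<lambda>n. measure M (\<Union>(A n))) sums measure M (\<Union>n. \<Union>(A n))"
    using meas disjfam by (intro finite_measure_UNION) auto
  moreover have "(\<lambda>n. measure M (\<Union>(A n))) sums (r - 0)"
    unfolding A(4) using telescope_sums'[OF \<rho>0] P0 by simp
  ultimately have "measure M (\<Union>n. \<Union>(A n)) = r"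
    using sums_unique2 by fastforce
  moreover have "(\<Union>n. \<Union>(A n)) = \<Union>(\<Union>n. A n)" by blast
  moreover have "disjoint (\<Union>n. A n)"
  proof (rule disjointI)
    fix K K' assume "K \<in> (\<Union>n. A n)" "K' \<in> (\<Union>n. A n)" "K \<noteq> K'"
    then obtain n m where "K \<in> A n" "K' \<in> A m" by auto
    then show "K \<inter> K' = {}"
    proof (cases n m rule: linorder_cases)
      case equal
      then show ?thesis
        using disjointD[OF disjoint_children[OF JT[of n]], of K K'] A(1)[of n]
          \<open>K \<in> A n\<close> \<open>K' \<in> A m\<close> \<open>K \<noteq> K'\<close> by blast
    qed (use disj_lt[of n m] disj_lt[of m n] in blast)+
  qed
  moreover have "\<Union>(\<Union>n. A n) \<subseteq> I"
    using AJ dec[of 0] P0 by blast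
  ultimately show ?thesis
    using AT by (intro that[of "\<Union>n. A n"] UN_least) simp_all
qed

end

section \<open>Layered functions\<close>

lemma ennpowr_mono_ennreal:
  assumes "0 \<le> p" "ennreal a \<le> x" "0 \<le> a"
  shows "ennreal (a powr p) \<le> ennpowr x p"
proof (cases "x = \<infinity>")
  case False
  then obtain b where "x = ennreal b" "0 \<le> b"
    by (cases x) auto
  with assms show ?thesis
    by (auto simp: ennpowr_def intro!: ennreal_leI powr_mono2)
qed (simp add: ennpowr_def)

lemma suminf_indicator_disjoint:
  fixes a :: "nat \<Rightarrow> 'b :: {semiring_1, t2_space, topological_comm_monoid_add}"
  assumes "disjoint_family D" "x \<in> D k"
  shows "(\<Sum>j. a j * indicator (D j) x) = a k"
proof -
  have "x \<notin> D j" if "j \<noteq> k" for j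
    using assms that by (auto simp: disjoint_family_on_def)
  then have "(\<Sum>j. a j * indicator (D j) x) = (\<Sum>j\<in>{k}. a j * indicator (D j) x)"
    by (intro suminf_finite) auto
  with assms show ?thesis by simp
qed

lemma suminf_shift_le_ennreal: "(\<Sum>j. a (j + k)) \<le> (\<Sum>j. a j :: ennreal)"
proof (rule suminf_le_const)
  fix n
  have "(\<Sum>j<n. a (j + k)) = sum a ((\<lambda>j. j + k) ` {..<n})"
    by (subst sum.reindex) auto
  also have "\<dots> \<le> (\<Sum>j. a j)"
    by (intro sum_le_suminf) auto
  finally show "(\<Sum>j<n. a (j + k)) \<le> (\<Sum>j. a j)" .
qed simp

context tree_prob_space
begin

text \<open>Each cell of generation \<open>k\<close> is replaced by a family filling the fraction
  \<open>s (Suc k) / s k\<close> of it. Hence every single cell of \<open>\<F> k\<close>, and not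
  only their union, contains the later sets in the same proportion; this is what makes all cells of
  one generation have equal averages later on.\<close>

lemma exists_nested_families:
  fixes s :: "nat \<Rightarrow> real"
  assumes s: "s 0 = 1" "\<And>k. 0 < s k" "\<And>k. s (Suc k) \<le> s k"
  obtains \<F> where "\<And>k. \<F> k \<subseteq> T" "\<And>k. disjoint (\<F> k)" "\<And>k. \<Union>(\<F> (Suc k)) \<subseteq> \<Union>(\<F> k)"
    "\<And>k. measure M (\<Union>(\<F> k)) = s k"
    "\<And>k j I. I \<in> \<F> k \<Longrightarrow> k \<le> j \<Longrightarrow> measure M (I \<inter> \<Union>(\<F> j)) = s j / s k * measure M I"
proof -
  define \<rho> where "\<rho> k = s (Suc k) / s k" for k
  have \<rho>: "0 < \<rho> k" "\<rho> k \<le> 1" for k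
    using s(2)[of k] s(2)[of "Suc k"] s(3)[of k] by (auto simp: \<rho>_def)
  define good where "good k I \<G> \<longleftrightarrow>
    \<G> \<subseteq> T \<and> disjoint \<G> \<and> \<Union>\<G> \<subseteq> I \<and> measure M (\<Union>\<G>) = \<rho> k * measure M I" for k I \<G>
  define pick where "pick k I = (SOME \<G>. good k I \<G>)" for k I
  have "good k I (pick k I)" if I: "I \<in> T" for k I
  proof -
    have "0 < \<rho> k * measure M I" "\<rho> k * measure M I \<le> measure M I"
      using \<rho>[of k] measure_T_pos[OF I] by (auto intro: mult_left_le_one_le)
    then have "\<exists>\<G>. good k I \<G>"
      using exists_subfamily_measure[OF I] unfolding good_def by metis
    then show ?thesis
      unfolding pick_def by (rule someI_ex)
  qed
  then have pick: "pick k I \<subseteq> T" "disjoint (pick k I)" "\<Union>(pick k I) \<subseteq> I"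
    "measure M (\<Union>(pick k I)) = \<rho> k * measure M I" if "I \<in> T" for k I
    using that by (simp_all add: good_def)
  define \<F> where "\<F> = rec_nat {space M} (\<lambda>k \<G>. \<Union>I\<in>\<G>. pick k I)"
  have F0: "\<F> 0 = {space M}" and FS: "\<F> (Suc k) = (\<Union>I\<in>\<F> k. pick k I)" for k
    by (simp_all add: \<F>_def)
  have FT: "\<F> k \<subseteq> T" for k
  proof (induction k)
    case (Suc k)
    then show ?case
      using pick(1) unfolding FS by (intro UN_least) blast
  qed (simp add: F0 space_in_T)
  have sub: "J \<subseteq> I" if "I \<in> \<F> k" "J \<in> pick k I" for I J k
    using pick(3)[of I k] FT[of k] that by blast
  have disj: "disjoint (\<F> k)" for k
  proof (induction k)
    case (Suc k)
    show ?case
    proof (rule disjointI)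
      fix A B assume "A \<in> \<F> (Suc k)" "B \<in> \<F> (Suc k)" "A \<noteq> B"
      then obtain A' B' where AB: "A' \<in> \<F> k" "B' \<in> \<F> k" "A \<in> pick k A'" "B \<in> pick k B'"
        by (auto simp: FS)
      show "A \<inter> B = {}"
      proof (cases "A' = B'")
        case True
        moreover have "A' \<in> T" using AB FT by blast
        ultimately show ?thesis
          using disjointD[OF pick(2)[of A' k], of A B] AB \<open>A \<noteq> B\<close> by simp
      next
        case False
        then have "A' \<inter> B' = {}"
          using disjointD[OF Suc AB(1,2)] by simp
        then show ?thesis
          using sub[OF AB(1,3)] sub[OF AB(2,4)] by blast
      qed
    qed
  qed (simp add: F0)
  have dec: "\<Union>(\<F> (Suc k)) \<subseteq> \<Union>(\<F> k)" for k
    using sub[of _ k] unfolding FS by blast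
  have cnt: "countable (\<F> k)" for k
    using FT countable_T countable_subset by blast
  have meas: "\<Union>(\<F> k) \<in> sets M" for k
    using FT[of k] T_sets cnt by (intro sets.countable_Union) auto
  \<comment> \<open>Families picked inside other cells of generation \<open>k\<close> cannot reach
    into \<open>I\<close>, because those cells are disjoint from it.\<close>
  have next_Int: "I \<inter> \<Union>(\<F> (Suc k)) = \<Union>(pick k I)" if "I \<in> \<F> k" for I k
  proof
    show "\<Union>(pick k I) \<subseteq> I \<inter> \<Union>(\<F> (Suc k))"
      using sub[OF that] that by (auto simp: FS)
    show "I \<inter> \<Union>(\<F> (Suc k)) \<subseteq> \<Union>(pick k I)"
    proof
      fix x assume "x \<in> I \<inter> \<Union>(\<F> (Suc k))"
      then obtain I' J where J: "x \<in> I" "x \<in> J" "I' \<in> \<F> k" "J \<in> pick k I'"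
        by (auto simp: FS)
      then have "x \<in> I'" using sub by blast
      then have "I' = I"
        using disjointD[OF disj[of k] J(3) that] J(1) by blast
      with J show "x \<in> \<Union>(pick k I)" by blast
    qed
  qed
  have nest: "J \<subseteq> I" if "k \<le> j" "I \<in> \<F> k" "J \<in> \<F> j" "J \<inter> I \<noteq> {}" for I J k j
    using that
  proof (induction j arbitrary: J rule: dec_induct)
    case base
    then show ?case using disjointD[OF disj[of k]] by blast
  next
    case (step j)
    then obtain J' where J': "J' \<in> \<F> j" "J \<in> pick j J'"
      by (auto simp: FS)
    then have "J \<subseteq> J'" by (rule sub)
    with step.IH[OF step.prems(1) J'(1)] step.prems(3) show ?case by blast
  qed
  have rel: "measure M (I \<inter> \<Union>(\<F> j)) = s j / s k * measure M I" if "I \<in> \<F> k" "k \<le> j" for I k j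
    using that(2)
  proof (induction j rule: dec_induct)
    case base
    have "I \<inter> \<Union>(\<F> k) = I" using that(1) by blast
    then show ?case using s(2)[of k] by simp
  next
    case (step j)
    \<comment> \<open>By \<open>nest\<close>, the generation \<open>j\<close> cells inside
      \<open>I\<close> cover all of \<open>I \<inter> \<Union>(\<F> j)\<close>, so the one-step
      proportion can be summed over them.\<close>
    define G where "G = {J \<in> \<F> j. J \<subseteq> I}"
    have G: "\<Union>G = I \<inter> \<Union>(\<F> j)"
      using nest[OF step.hyps(1) that(1)] unfolding G_def by blast
    have "measure M (\<Union>G \<inter> \<Union>(\<F> (Suc j))) = \<rho> j * measure M (\<Union>G)"
    proof (rule measure_Union_Int_eq_cmult)
      show "countable G"
        using cnt[of j] by (auto simp: G_def intro: countable_subset)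
      show "disjoint G"
        using disj[of j] by (rule pairwise_subset) (auto simp: G_def)
      show "G \<subseteq> sets M"
        using FT[of j] T_sets by (auto simp: G_def)
      show "measure M (J \<inter> \<Union>(\<F> (Suc j))) = \<rho> j * measure M J" if "J \<in> G" for J
        using that FT[of j] pick(4)[of J j] next_Int[of J j] by (auto simp: G_def)
    qed (use meas \<rho>[of j] finite_measure_axioms in auto)
    moreover have "\<Union>G \<inter> \<Union>(\<F> (Suc j)) = I \<inter> \<Union>(\<F> (Suc j))"
      unfolding G using dec[of j] by blast
    ultimately show ?case
      using step.IH s(2)[of j] by (simp add: G \<rho>_def)
  qed
  have "measure M (\<Union>(\<F> k)) = s k" for k
  proof -
    have "space M \<inter> \<Union>(\<F> k) = \<Union>(\<F> k)"
      using sets.sets_into_space[OF meas[of k]] by blast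
    then show ?thesis
      using rel[of "space M" 0 k] s(1) by (simp add: F0 prob_space)
  qed
  then show thesis
    using FT disj dec rel by (intro that[of \<F>])
qed

text \<open>The hypothesis on \<open>A\<close> says that \<open>A k\<close> is the average of \<phi>
  over the \<open>k\<close>-th nested set. By proportionality it is also the average over each cell
  of generation \<open>k\<close>, so the maximal function is at least \<open>A k\<close> on the
  \<open>k\<close>-th layer. A general \<open>g\<close> serves \<phi> and its \<open>p\<close>-th
  power at once; \<open>g 0 = 0\<close> makes the complement of all layers contribute
  nothing.\<close>

lemma exists_layered_function:
  fixes s c A :: "nat \<Rightarrow> real"
  assumes s: "s 0 = 1" "\<And>k. 0 < s k" "\<And>k. s (Suc k) \<le> s k"
    and c: "\<And>k. 0 \<le> c k"
    and A: "\<And>k. (\<lambda>j. c (j + k) * (s (j + k) - s (Suc (j + k)))) sums (A k * s k)"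
  shows "\<exists>\<phi>\<in>borel_measurable M. (\<forall>x. 0 \<le> \<phi> x) \<and>
    (\<forall>g :: real \<Rightarrow> ennreal. g 0 = 0 \<longrightarrow> (\<integral>\<^sup>+x. g (\<phi> x) \<partial>M) = (\<Sum>k. g (c k) * ennreal (s k - s (Suc k)))) \<and>
    (\<forall>L p. 0 \<le> L \<longrightarrow> 0 \<le> p \<longrightarrow> (\<Sum>k. ennreal (max (A k) L powr p) * ennreal (s k - s (Suc k)))
       \<le> (\<integral>\<^sup>+x. ennpowr (max (dyadic_maximal M T \<phi> x) (ennreal L)) p \<partial>M))"
proof -
  obtain \<F> where FT: "\<And>k. \<F> k \<subseteq> T" and disj: "\<And>k. disjoint (\<F> k)"
    and dec: "\<And>k. \<Union>(\<F> (Suc k)) \<subseteq> \<Union>(\<F> k)" and mF: "\<And>k. measure M (\<Union>(\<F> k)) = s k"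
    and rel: "\<And>k j I. I \<in> \<F> k \<Longrightarrow> k \<le> j \<Longrightarrow> measure M (I \<inter> \<Union>(\<F> j)) = s j / s k * measure M I"
    using exists_nested_families[OF s] by metis
  have meas[measurable]: "\<Union>(\<F> k) \<in> sets M" for k
    using FT[of k] T_sets countable_T by (intro sets.countable_Union) (auto intro: countable_subset)
  define D where "D k = \<Union>(\<F> k) - \<Union>(\<F> (Suc k))" for k
  have D_meas[measurable]: "D k \<in> sets M" for k
    unfolding D_def by measurable
  have "\<Union>(\<F> m) \<subseteq> \<Union>(\<F> n)" if "n \<le> m" for n m
    using dec that by (rule lift_Suc_antimono_le)
  then have "D n \<inter> D m = {}" if "n < m" for n m
    using that[THEN Suc_leI] unfolding D_def by blast
  then have disjD: "disjoint_family D"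
    unfolding disjoint_family_on_def by (metis Int_commute linorder_neqE_nat)
  have emD: "emeasure M (D k) = ennreal (s k - s (Suc k))" for k
    unfolding D_def emeasure_eq_measure using dec[of k] mF by (simp add: finite_measure_Diff)
  \<comment> \<open>At most one term of the series is nonzero at each point; the series form makes
    measurability immediate and yields 0 off the layers.\<close>
  define \<phi> where "\<phi> x = (\<Sum>k. c k * indicator (D k) x)" for x
  have \<phi>_in: "\<phi> x = c k" if "x \<in> D k" for x k
    unfolding \<phi>_def using disjD that by (rule suminf_indicator_disjoint)
  have \<phi>_out: "\<phi> x = 0" if "x \<notin> (\<Union>k. D k)" for x
    using that by (simp add: \<phi>_def)
  have \<phi>_meas[measurable]: "\<phi> \<in> borel_measurable M"
    unfolding \<phi>_def by measurable
  have \<phi>_nonneg: "0 \<le> \<phi> x" for x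
    using \<phi>_in \<phi>_out c by (cases "x \<in> (\<Union>k. D k)") auto
  have g\<phi>: "g (\<phi> x) = (\<Sum>k. g (c k) * indicator (D k) x)" if "g 0 = 0" for g :: "real \<Rightarrow> ennreal" and x
  proof (cases "x \<in> (\<Union>k. D k)")
    case True
    then obtain k where "x \<in> D k" by auto
    then show ?thesis
      using suminf_indicator_disjoint[OF disjD, of x k "\<lambda>k. g (c k)"] \<phi>_in by simp
  next
    case False
    then show ?thesis using \<phi>_out that by simp
  qed
  have int_D: "(\<integral>\<^sup>+x. (\<Sum>k. a k * indicator (D k) x) \<partial>M) = (\<Sum>k. a k * ennreal (s k - s (Suc k)))"
    for a :: "nat \<Rightarrow> ennreal"
    by (subst nn_integral_suminf) (auto simp: nn_integral_cmult emD)
  have max_ge: "ennreal (A k) \<le> dyadic_maximal M T \<phi> x" if x: "x \<in> D k" for x k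
  proof -
    obtain I where I: "I \<in> \<F> k" "x \<in> I"
      using x by (auto simp: D_def)
    then have IT: "I \<in> T" using FT by blast
    note [measurable] = in_sets[OF IT]
    have ID: "emeasure M (D (j + k) \<inter> I) = ennreal ((s (j + k) - s (Suc (j + k))) * (measure M I / s k))" for j
    proof -
      have *: "D (j + k) \<inter> I = I \<inter> \<Union>(\<F> (j + k)) - I \<inter> \<Union>(\<F> (Suc (j + k)))"
        by (auto simp: D_def)
      have "measure M (D (j + k) \<inter> I) = measure M (I \<inter> \<Union>(\<F> (j + k))) - measure M (I \<inter> \<Union>(\<F> (Suc (j + k))))"
        unfolding * by (intro finite_measure_Diff sets.Int meas in_sets[OF IT] Int_mono order_refl dec)
      also have "\<dots> = (s (j + k) - s (Suc (j + k))) * (measure M I / s k)"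
        using rel[OF I(1), of "j + k"] rel[OF I(1), of "Suc (j + k)"] by (simp add: field_simps diff_divide_distrib)
      finally show ?thesis by (simp add: emeasure_eq_measure)
    qed
    have "(\<lambda>j. c (j + k) * (s (j + k) - s (Suc (j + k))) * (measure M I / s k)) sums (A k * s k * (measure M I / s k))"
      by (intro sums_mult2 A)
    moreover have "A k * s k * (measure M I / s k) = A k * measure M I"
      using s(2)[of k] by simp
    ultimately have sums: "(\<lambda>j. c (j + k) * (s (j + k) - s (Suc (j + k))) * (measure M I / s k)) sums (A k * measure M I)"
      by simp
    \<comment> \<open>Only the layers from \<open>k\<close> on are counted inside \<open>I\<close>.
      Passing to all layers can only increase the sum, which is then the integral of \<phi> over
      \<open>I\<close>.\<close>
    have "ennreal (A k * measure M I) = (\<Sum>j. ennreal (c (j + k) * (s (j + k) - s (Suc (j + k))) * (measure M I / s k)))"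
      using c s(3) s(2)[of k] by (intro suminf_ennreal_eq[OF _ sums, symmetric]) (auto intro!: mult_nonneg_nonneg divide_nonneg_pos)
    also have "\<dots> = (\<Sum>j. ennreal (c (j + k)) * emeasure M (D (j + k) \<inter> I))"
      by (simp only: ID mult.assoc ennreal_mult'[OF c])
    also have "\<dots> \<le> (\<Sum>j. ennreal (c j) * emeasure M (D j \<inter> I))"
      by (rule suminf_shift_le_ennreal)
    also have "\<dots> = (\<integral>\<^sup>+y. (\<Sum>j. ennreal (c j) * indicator (D j \<inter> I) y) \<partial>M)"
      by (subst nn_integral_suminf) (auto simp: nn_integral_cmult)
    also have "\<dots> = (\<integral>\<^sup>+y. (\<Sum>j. ennreal (c j) * indicator (D j) y) * indicator I y \<partial>M)"
      by (intro nn_integral_cong) (auto simp: indicator_inter_arith split: split_indicator)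
    also have "\<dots> = (\<integral>\<^sup>+y\<in>I. ennreal \<bar>\<phi> y\<bar> \<partial>M)"
      using g\<phi>[of ennreal] \<phi>_nonneg by simp
    finally have "ennreal (A k * measure M I) / emeasure M I \<le> (\<integral>\<^sup>+y\<in>I. ennreal \<bar>\<phi> y\<bar> \<partial>M) / emeasure M I"
      by (rule divide_right_mono_ennreal)
    moreover have "0 \<le> A k"
    proof -
      have "0 \<le> A k * s k"
        by (rule sums_le[OF _ sums_zero A[of k]]) (simp add: c s(3))
      then show ?thesis using s(2)[of k] by (simp add: zero_le_mult_iff not_le[symmetric])
    qed
    ultimately have "ennreal (A k) \<le> (\<integral>\<^sup>+y\<in>I. ennreal \<bar>\<phi> y\<bar> \<partial>M) / emeasure M I"
      using measure_T_pos[OF IT] by (simp add: emeasure_eq_measure divide_ennreal)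
    also have "\<dots> \<le> dyadic_maximal M T \<phi> x"
      unfolding dyadic_maximal_def using IT I by (intro SUP_upper) auto
    finally show ?thesis .
  qed
  show ?thesis
  proof (intro bexI[of _ \<phi>] conjI allI impI)
    show "(\<integral>\<^sup>+x. g (\<phi> x) \<partial>M) = (\<Sum>k. g (c k) * ennreal (s k - s (Suc k)))"
      if "g 0 = 0" for g :: "real \<Rightarrow> ennreal"
      unfolding g\<phi>[of g, OF that] by (rule int_D)
    show "(\<Sum>k. ennreal (max (A k) L powr p) * ennreal (s k - s (Suc k)))
       \<le> (\<integral>\<^sup>+x. ennpowr (max (dyadic_maximal M T \<phi> x) (ennreal L)) p \<partial>M)" if "0 \<le> L" "0 \<le> p" for L p
      unfolding int_D[symmetric]
    proof (intro nn_integral_mono)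
      fix x
      show "(\<Sum>k. ennreal (max (A k) L powr p) * indicator (D k) x)
        \<le> ennpowr (max (dyadic_maximal M T \<phi> x) (ennreal L)) p"
      proof (cases "x \<in> (\<Union>k. D k)")
        case True
        then obtain k where k: "x \<in> D k" by auto
        have "ennreal (max (A k) L) \<le> max (dyadic_maximal M T \<phi> x) (ennreal L)"
          using max_ge[OF k] by (auto simp: max_def)
        then have "ennreal (max (A k) L powr p) \<le> ennpowr (max (dyadic_maximal M T \<phi> x) (ennreal L)) p"
          using that by (intro ennpowr_mono_ennreal) auto
        then show ?thesis
          by (simp add: suminf_indicator_disjoint[OF disjD k])
      next
        case False
        then show ?thesis by simp
      qed
    qed
  qed (use \<phi>_nonneg in auto)
qed

end

section \<open>The function \<open>H\<^sub>p\<close> and its inverse\<close>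

lemma H_fun_factored: "0 < z \<Longrightarrow> H_fun p z = z powr (p - 1) * (p - (p - 1) * z)"
  by (simp add: H_fun_def powr_diff field_simps)

text \<open>The right side is the numerator inside \<open>omega_fun\<close> in the theorem. So that
  argument equals \<open>f powr p / F\<close> times \<open>H_fun p (L / f)\<close>, and it lies in
  (0, 1] whenever \<open>f \<le> L < p / (p - 1) * f\<close> and
  \<open>f powr p \<le> F\<close>.\<close>

lemma H_fun_ratio:
  assumes "0 < f" "0 < L"
  shows "f powr p * H_fun p (L / f) = p * L powr (p - 1) * f - (p - 1) * L powr p"
proof -
  have "f powr p * (L / f) powr p = L powr p" "f powr p * (L / f) powr (p - 1) = L powr (p - 1) * f"
    using assms by (simp_all add: powr_divide powr_diff)
  moreover have "f powr p * H_fun p (L / f)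
      = p * (f powr p * (L / f) powr (p - 1)) - (p - 1) * (f powr p * (L / f) powr p)"
    by (simp add: H_fun_def algebra_simps)
  ultimately show ?thesis by simp
qed

lemma H_fun_1 [simp]: "H_fun p 1 = 1"
  by (simp add: H_fun_def)

lemma H_fun_conjugate: "1 < p \<Longrightarrow> H_fun p (p / (p - 1)) = 0"
  by (simp add: H_fun_factored)

text \<open>The derivative is p (p - 1) z^(p-2) (1 - z), negative for z > 1. It vanishes at 1, hence
  the criterion that asks for the sign on the open interval and continuity at its ends.\<close>

lemma H_fun_strict_antimono:
  assumes "1 < p" "1 \<le> x" "x < y"
  shows "H_fun p y < H_fun p x"
proof (rule DERIV_neg_imp_decreasing_open[OF assms(3)])
  fix z assume "x < z" "z < y"
  with assms have z: "1 < z" by simp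
  have "(H_fun p has_real_derivative - (p - 1) * (p * z powr (p - 1)) + p * ((p - 1) * z powr (p - 1 - 1))) (at z)"
    unfolding H_fun_def[abs_def] using z by (auto intro!: derivative_eq_intros)
  moreover have "- (p - 1) * (p * z powr (p - 1)) + p * ((p - 1) * z powr (p - 1 - 1))
      = p * (p - 1) * (z powr (p - 1 - 1) * (1 - z))"
  proof -
    have "z powr (p - 1) = z powr (p - 1 - 1) * z"
      using z powr_add[of z "p - 1 - 1" 1] by simp
    then show ?thesis by (simp only:) (simp add: algebra_simps)
  qed
  moreover have "p * (p - 1) * (z powr (p - 1 - 1) * (1 - z)) < 0"
    using z assms by (intro mult_pos_neg) (auto intro!: mult_pos_neg)
  ultimately show "\<exists>D. (H_fun p has_real_derivative D) (at z) \<and> D < 0"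
    by metis
next
  show "continuous_on {x..y} (H_fun p)"
    unfolding H_fun_def[abs_def] using assms by (auto intro!: continuous_intros)
qed

lemma H_fun_less_iff:
  assumes "1 < p" "1 \<le> x" "1 \<le> y"
  shows "H_fun p x < H_fun p y \<longleftrightarrow> y < x"
  using H_fun_strict_antimono[OF assms(1), of x y] H_fun_strict_antimono[OF assms(1), of y x] assms
  by (cases x y rule: linorder_cases) auto

lemma H_fun_pos: "1 < p \<Longrightarrow> 1 \<le> z \<Longrightarrow> z < p / (p - 1) \<Longrightarrow> 0 < H_fun p z"
  using H_fun_strict_antimono[of p z "p / (p - 1)"] H_fun_conjugate[of p] by simp

lemma continuous_H_fun: "0 < z \<Longrightarrow> isCont (H_fun p) z"
  unfolding H_fun_def[abs_def] by (auto intro!: continuous_intros)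

lemma omega_fun_inverse:
  assumes p: "1 < p" and y: "0 \<le> y" "y \<le> 1"
  shows "1 \<le> omega_fun p y" "omega_fun p y \<le> p / (p - 1)" "H_fun p (omega_fun p y) = y"
proof -
  have "1 \<le> p / (p - 1)" using p by simp
  then have "\<exists>z\<ge>1. z \<le> p / (p - 1) \<and> H_fun p z = y"
    using y p by (intro IVT2) (auto simp: H_fun_conjugate intro!: continuous_H_fun)
  then have "y \<in> H_fun p ` {1..p / (p - 1)}" by force
  then show "1 \<le> omega_fun p y" "omega_fun p y \<le> p / (p - 1)" "H_fun p (omega_fun p y) = y"
    unfolding omega_fun_def using inv_into_into[of y "H_fun p" "{1..p / (p - 1)}"]
    by (auto simp: f_inv_into_f)
qed

lemma omega_fun_H_fun:
  assumes "1 < p" "1 \<le> z" "z \<le> p / (p - 1)"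
  shows "omega_fun p (H_fun p z) = z"
proof -
  have "inj_on (H_fun p) {1..p / (p - 1)}"
    using H_fun_less_iff[OF assms(1)] by (intro inj_onI) (metis atLeastAtMost_iff less_irrefl linorder_cases)
  then show ?thesis
    unfolding omega_fun_def using assms by (intro inv_into_f_f) auto
qed

section \<open>Lower bound\<close>

lemma sums_prependI:
  fixes g :: "nat \<Rightarrow> real"
  assumes "(\<lambda>k. g (Suc k)) sums l" "g 0 + l = m"
  shows "g sums m"
  using sums_Suc[OF assms(1)] assms(2) by (simp add: add.commute)

lemma sums_prepend2:
  fixes g :: "nat \<Rightarrow> real"
  assumes "(\<lambda>k. g (Suc (Suc k))) sums l"
  shows "g sums (g 0 + (g 1 + l))"
  using sums_Suc[OF sums_Suc[OF assms]] by (simp add: algebra_simps)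

lemma powr_power_commute: "0 < x \<Longrightarrow> (x ^ k) powr p = (x powr p) ^ k" for x :: real
  by (simp add: powr_powr mult.commute flip: powr_realpow)

text \<open>With \<open>?h\<close> the term subtracted from 1 in the denominator,
  \<open>?h 0 = 1\<close>, so the quotient is minus the reciprocal of the difference quotient of
  \<open>?h\<close> at 0. The derivative there is p (1 - 1/a) - 1, which equals - H_p(a) /
  a^p.\<close>

lemma geometric_quotient_tendsto:
  fixes a p :: real
  assumes a: "1 < a" and p: "1 < p" and H: "0 < H_fun p a"
  shows "((\<lambda>\<alpha>. \<alpha> / (1 - ((1 - \<alpha> / a) / (1 - \<alpha>)) powr p * (1 - \<alpha>))) \<longlongrightarrow> a powr p / H_fun p a) (at_right 0)"
proof -
  let ?h = "\<lambda>\<alpha>. ((1 - \<alpha> / a) / (1 - \<alpha>)) powr p * (1 - \<alpha>)"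
  have "(?h has_real_derivative (p * (1 - 1 / a) - 1)) (at 0)"
    using a by (auto intro!: derivative_eq_intros simp: field_simps)
  then have "(\<lambda>\<alpha>. (?h \<alpha> - 1) / \<alpha>) \<midarrow>0\<rightarrow> p * (1 - 1 / a) - 1"
    by (simp add: DERIV_def)
  then have "((\<lambda>\<alpha>. (?h \<alpha> - 1) / \<alpha>) \<longlongrightarrow> p * (1 - 1 / a) - 1) (at_right 0)"
    by (rule filterlim_mono) (auto simp: at_le)
  moreover have "p * (1 - 1 / a) - 1 = - (H_fun p a / a powr p)"
    using a by (simp add: H_fun_factored powr_diff field_simps)
  ultimately have "((\<lambda>\<alpha>. - inverse ((?h \<alpha> - 1) / \<alpha>)) \<longlongrightarrow> - inverse (- (H_fun p a / a powr p))) (at_right 0)"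
    using H a by (intro tendsto_minus tendsto_inverse) auto
  moreover have "- inverse ((x - 1) / \<alpha>) = \<alpha> / (1 - x)" for x \<alpha> :: real
    by (cases "x = 1") (auto simp: field_simps)
  ultimately show ?thesis
    by simp
qed

section \<open>Test functions with geometric layers and their limits\<close>

context tree_prob_space
begin

text \<open>From the third layer on, a fraction \<alpha> of the nested set is split off at each
  step, the value there is \<open>L / a * \<beta> ^ k\<close> and the average over the nested set is
  \<open>L * \<beta> ^ k\<close>, that is, \<open>a\<close> times the value. \<open>Q\<close> is the
  sum of the geometric series of \<open>p\<close>-th powers. The assumption on \<open>F\<close>
  leaves enough of the \<open>p\<close>-th moment for the part outside: by Hoelder it must be at
  least the second summand.\<close>

lemma bellman_ge_geometric:
  assumes p: "1 < p" and f: "0 < f" "f \<le> L" and \<kappa>: "0 < \<kappa>" "\<kappa> < 1" "\<kappa> * L < f"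
    and a: "1 < a" and \<alpha>: "0 < \<alpha>" "\<alpha> < 1"
    and Q: "Q = \<alpha> / (1 - ((1 - \<alpha> / a) / (1 - \<alpha>)) powr p * (1 - \<alpha>))" "0 < Q"
    and F: "\<kappa> * ((L / a) powr p * Q) + (f - \<kappa> * L) powr p / (1 - \<kappa>) powr (p - 1) \<le> F"
  shows "ennreal (L powr p * (1 - \<kappa>) + \<kappa> * L powr p * Q) \<le> bellman M T p f F L"
proof -
  \<comment> \<open>Solves \<open>\<alpha> * (L / a) + (1 - \<alpha>) * \<beta> * L = L\<close>:
    splitting off value \<open>L / a\<close> from average \<open>L\<close> raises the average of the
    remainder to \<open>\<beta> * L\<close>.\<close>
  define \<beta> where "\<beta> = (1 - \<alpha> / a) / (1 - \<alpha>)"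
  have "\<alpha> / a < \<alpha>" using a \<alpha> by (simp add: divide_less_eq)
  then have \<beta>: "1 < \<beta>" using \<alpha> by (simp add: \<beta>_def)
  have \<beta>\<delta>: "1 - \<beta> * (1 - \<alpha>) = \<alpha> / a"
    using \<alpha> by (simp add: \<beta>_def)
  define r where "r = \<beta> powr p * (1 - \<alpha>)"
  have Qr: "Q = \<alpha> / (1 - r)" using Q by (simp add: r_def \<beta>_def)
  have r: "0 < r" "r < 1"
    using Q(2) \<alpha> \<beta> unfolding Qr by (auto simp: r_def zero_less_divide_iff)
  define B where "B = f - \<kappa> * L"
  define F1 where "F1 = F - \<kappa> * ((L / a) powr p * Q)"
  have B: "0 < B" using \<kappa> by (simp add: B_def)
  have L: "0 < L" using f by simp
  have F1: "B powr p / (1 - \<kappa>) powr (p - 1) \<le> F1"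
    using F by (simp add: B_def F1_def)
  have "0 < B powr p / (1 - \<kappa>) powr (p - 1)"
    using B \<kappa> by simp
  with F1 have F1_pos: "0 < F1" by simp
  \<comment> \<open>A single layer of value \<open>d\<close> and measure \<open>w\<close> must carry
    what is left of both integrals: \<open>d * w = B\<close> and
    \<open>d powr p * w = F1\<close>.\<close>
  define d where "d = (F1 / B) powr (1 / (p - 1))"
  have d: "0 < d" "d powr (p - 1) = F1 / B"
    using F1_pos B p by (auto simp: d_def powr_powr)
  define w where "w = B / d"
  have dw: "d * w = B" and w: "0 < w"
    using d B by (auto simp: w_def)
  have dpw: "d powr p * w = F1"
  proof -
    have "d powr p * w = d powr (p - 1) * (d * w)"
      using d(1) by (simp add: powr_diff)
    also have "\<dots> = F1 / B * B" by (simp only: d(2) dw)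
    finally show ?thesis using B by simp
  qed
  \<comment> \<open>This is the Hoelder condition in disguise; it gives
    \<open>w \<le> 1 - \<kappa>\<close>, so that the layer of value \<open>d\<close> fits outside
    the set of measure \<kappa>.\<close>
  have "(B / (1 - \<kappa>)) powr (p - 1) \<le> d powr (p - 1)"
  proof -
    have "(B / (1 - \<kappa>)) powr (p - 1) = B powr p / (1 - \<kappa>) powr (p - 1) / B"
      using B \<kappa> by (simp add: powr_divide powr_diff)
    also have "\<dots> \<le> F1 / B"
      using F1 B by (intro divide_right_mono) auto
    finally show ?thesis using d by simp
  qed
  then have "B / (1 - \<kappa>) \<le> d"
    using p d(1) powr_less_mono2[of "p - 1" d "B / (1 - \<kappa>)"] by force
  then have w1: "w \<le> 1 - \<kappa>"
    using d \<kappa> by (simp add: w_def field_simps)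
  \<comment> \<open>Layer 0 has value 0 and measure \<open>1 - \<kappa> - w\<close>, layer 1 has
    value \<open>d\<close> and measure \<open>w\<close>, and the geometric layers fill the remaining
    measure \<kappa>.\<close>
  define s where "s = case_nat 1 (case_nat (\<kappa> + w) (\<lambda>k. \<kappa> * (1 - \<alpha>) ^ k))"
  define c where "c = case_nat 0 (case_nat d (\<lambda>k. L / a * \<beta> ^ k))"
  define A where "A = case_nat f (case_nat (f / (\<kappa> + w)) (\<lambda>k. L * \<beta> ^ k))"
  have s_simps: "s 0 = 1" "s (Suc 0) = \<kappa> + w" "s (Suc (Suc k)) = \<kappa> * (1 - \<alpha>) ^ k" for k
    by (simp_all add: s_def)
  have c_simps: "c 0 = 0" "c (Suc 0) = d" "c (Suc (Suc k)) = L / a * \<beta> ^ k" for k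
    by (simp_all add: c_def)
  have A_simps: "A 0 = f" "A (Suc 0) = f / (\<kappa> + w)" "A (Suc (Suc k)) = L * \<beta> ^ k" for k
    by (simp_all add: A_def)
  have s_pos: "0 < s k" for k
    using \<kappa> w \<alpha> by (auto simp: s_def split: nat.split)
  have c_nonneg: "0 \<le> c k" for k
    using d L a \<beta> by (auto simp: c_def split: nat.split)
  have s_dec: "s (Suc k) \<le> s k" for k
  proof -
    have "(1 - \<alpha>) * (1 - \<alpha>) ^ j \<le> (1 - \<alpha>) ^ j" for j
      using \<alpha> by (intro mult_left_le_one_le) auto
    then show ?thesis
      using w1 w \<kappa> \<alpha> by (auto simp: s_def split: nat.split)
  qed
  have step: "\<kappa> * (1 - \<alpha>) ^ n - \<kappa> * (1 - \<alpha>) ^ Suc n = \<kappa> * \<alpha> * (1 - \<alpha>) ^ n" for n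
    by (simp add: algebra_simps)
  have tail: "(\<lambda>j. L / a * \<beta> ^ (j + k) * (\<kappa> * (1 - \<alpha>) ^ (j + k) - \<kappa> * (1 - \<alpha>) ^ Suc (j + k)))
      sums (L * \<beta> ^ k * (\<kappa> * (1 - \<alpha>) ^ k))" for k
  proof -
    \<comment> \<open>The common ratio of the series for the averages is
      \<open>1 - \<alpha> / a\<close>. The series of \<open>p\<close>-th powers has ratio
      \<open>r\<close>, and \<open>r < 1\<close> came from \<open>0 < Q\<close>.\<close>
    have "norm (\<beta> * (1 - \<alpha>)) < 1"
    proof -
      have "0 < \<alpha> / a" using \<alpha> a by simp
      with \<beta>\<delta> have "\<beta> * (1 - \<alpha>) < 1" by linarith
      then show ?thesis using \<beta> \<alpha> by simp
    qed
    then have "(\<lambda>j. L / a * \<kappa> * \<alpha> * (\<beta> * (1 - \<alpha>)) ^ k * (\<beta> * (1 - \<alpha>)) ^ j) sums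
        (L / a * \<kappa> * \<alpha> * (\<beta> * (1 - \<alpha>)) ^ k * (1 / (1 - \<beta> * (1 - \<alpha>))))"
      by (intro sums_mult geometric_sums)
    moreover have "L / a * \<kappa> * \<alpha> * (\<beta> * (1 - \<alpha>)) ^ k * (1 / (1 - \<beta> * (1 - \<alpha>))) = L * \<beta> ^ k * (\<kappa> * (1 - \<alpha>) ^ k)"
      unfolding \<beta>\<delta> using \<alpha> a by (simp add: power_mult_distrib)
    moreover have "L / a * \<kappa> * \<alpha> * (\<beta> * (1 - \<alpha>)) ^ k * (\<beta> * (1 - \<alpha>)) ^ j
        = L / a * \<beta> ^ (j + k) * (\<kappa> * (1 - \<alpha>) ^ (j + k) - \<kappa> * (1 - \<alpha>) ^ Suc (j + k))" for j
      unfolding step by (simp only: power_mult_distrib power_add mult_ac times_divide_eq_left times_divide_eq_right)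
    ultimately show ?thesis by (simp only:)
  qed
  have sums_A: "(\<lambda>j. c (j + k) * (s (j + k) - s (Suc (j + k)))) sums (A k * s k)" for k
  proof -
    define t where "t j = c j * (s j - s (Suc j))" for j
    have t2: "(\<lambda>j. t (Suc (Suc j))) sums (L * \<kappa>)"
      using tail[of 0] by (simp add: t_def s_simps c_simps)
    have t1: "(\<lambda>j. t (Suc j)) sums f"
      by (rule sums_prependI[OF t2]) (use dw in \<open>simp add: t_def s_simps c_simps B_def mult.commute\<close>)
    have t0: "t sums f"
      by (rule sums_prependI[OF t1]) (simp add: t_def c_simps)
    consider "k = 0" | "k = Suc 0" | j where "k = Suc (Suc j)"
      by (metis not0_implies_Suc)
    then show ?thesis
    proof cases
      case 1
      then show ?thesis using t0 by (simp add: t_def[abs_def] s_simps A_simps)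
    next
      case 2
      then show ?thesis using t1 \<kappa> w by (simp add: t_def s_simps A_simps)
    next
      case 3
      then show ?thesis
        using tail[of j] by (simp add: s_simps c_simps A_simps)
    qed
  qed
  have tail_p: "(\<lambda>k. u * (\<beta> ^ k) powr p * (\<kappa> * (1 - \<alpha>) ^ k - \<kappa> * (1 - \<alpha>) ^ Suc k)) sums (u * \<kappa> * Q)" for u
  proof -
    have "(\<lambda>k. u * \<kappa> * \<alpha> * r ^ k) sums (u * \<kappa> * \<alpha> * (1 / (1 - r)))"
      using r by (intro sums_mult geometric_sums) auto
    moreover have "u * \<kappa> * \<alpha> * r ^ k = u * (\<beta> ^ k) powr p * (\<kappa> * (1 - \<alpha>) ^ k - \<kappa> * (1 - \<alpha>) ^ Suc k)" for k
      unfolding step using \<beta> by (simp add: powr_power_commute r_def power_mult_distrib)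
    moreover have "u * \<kappa> * \<alpha> * (1 / (1 - r)) = u * \<kappa> * Q"
      by (simp add: Qr)
    ultimately show ?thesis by (simp only:)
  qed
  have sums_cp: "(\<lambda>k. c k powr p * (s k - s (Suc k))) sums F"
  proof -
    have "(\<lambda>k. c (Suc (Suc k)) powr p * (s (Suc (Suc k)) - s (Suc (Suc (Suc k))))) sums ((L / a) powr p * \<kappa> * Q)"
    proof -
      have "(L / a * \<beta> ^ k) powr p = (L / a) powr p * (\<beta> ^ k) powr p" for k
        using L a \<beta> by (intro powr_mult)
      then show ?thesis
        unfolding c_simps s_simps using tail_p[of "(L / a) powr p"] by (simp only:)
    qed
    from sums_prepend2[OF this] show ?thesis
      using dpw by (simp add: c_simps s_simps F1_def algebra_simps)
  qed
  \<comment> \<open>On the first two layers only the floor \<open>L\<close> is used; on the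
    geometric layers the averages are at least \<open>L\<close> and replace it.\<close>
  define b where "b = case_nat (L powr p) (case_nat (L powr p) (\<lambda>k. L powr p * (\<beta> ^ k) powr p))"
  have b_simps: "b 0 = L powr p" "b (Suc 0) = L powr p" "b (Suc (Suc k)) = L powr p * (\<beta> ^ k) powr p" for k
    by (simp_all add: b_def)
  have sums_b: "(\<lambda>k. b k * (s k - s (Suc k))) sums (L powr p * (1 - \<kappa>) + \<kappa> * L powr p * Q)"
  proof -
    have "(\<lambda>k. b (Suc (Suc k)) * (s (Suc (Suc k)) - s (Suc (Suc (Suc k))))) sums (L powr p * \<kappa> * Q)"
      using tail_p[of "L powr p"] by (simp add: b_simps s_simps)
    from sums_prepend2[OF this] show ?thesis
      by (simp add: b_simps s_simps algebra_simps)
  qed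
  have b_le: "b k \<le> max (A k) L powr p" and b_nonneg: "0 \<le> b k" for k
  proof -
    consider "k = 0" | "k = Suc 0" | j where "k = Suc (Suc j)"
      by (metis not0_implies_Suc)
    then have "b k \<le> max (A k) L powr p \<and> 0 \<le> b k"
    proof cases
      case (3 j)
      have "L * 1 \<le> L * \<beta> ^ j"
        using L \<beta> by (intro mult_left_mono one_le_power) auto
      then have "max (A k) L = L * \<beta> ^ j"
        using 3 by (simp add: A_simps max_def)
      then show ?thesis
        using 3 L \<beta> by (simp add: b_simps powr_mult)
    qed (use L p in \<open>auto simp: b_simps A_simps intro!: powr_mono2\<close>)
    then show "b k \<le> max (A k) L powr p" "0 \<le> b k" by auto
  qed
  have sdiff: "0 \<le> s k - s (Suc k)" for k
    using s_dec[of k] by simp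
  obtain \<phi> where \<phi>: "\<phi> \<in> borel_measurable M" "\<forall>x. 0 \<le> \<phi> x"
    "\<forall>g :: real \<Rightarrow> ennreal. g 0 = 0 \<longrightarrow> (\<integral>\<^sup>+x. g (\<phi> x) \<partial>M) = (\<Sum>k. g (c k) * ennreal (s k - s (Suc k)))"
    "\<forall>L p. 0 \<le> L \<longrightarrow> 0 \<le> p \<longrightarrow> (\<Sum>k. ennreal (max (A k) L powr p) * ennreal (s k - s (Suc k)))
       \<le> (\<integral>\<^sup>+x. ennpowr (max (dyadic_maximal M T \<phi> x) (ennreal L)) p \<partial>M)"
    using exists_layered_function[of s c A, OF s_simps(1) s_pos s_dec c_nonneg sums_A] by auto
  have "(\<integral>\<^sup>+x. ennreal (\<phi> x) \<partial>M) = (\<Sum>k. ennreal (c k * (s k - s (Suc k))))"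
    by (subst \<phi>(3)[rule_format]) (simp_all add: ennreal_mult'[OF c_nonneg])
  also have "\<dots> = ennreal f"
    using sums_A[of 0] c_nonneg sdiff by (intro suminf_ennreal_eq) (auto simp: A_simps s_simps)
  finally have int1: "(\<integral>\<^sup>+x. ennreal (\<phi> x) \<partial>M) = ennreal f" .
  have "(\<integral>\<^sup>+x. ennreal (\<phi> x powr p) \<partial>M) = (\<Sum>k. ennreal (c k powr p * (s k - s (Suc k))))"
    by (subst \<phi>(3)[rule_format]) (use p in \<open>simp_all add: ennreal_mult'\<close>)
  also have "\<dots> = ennreal F"
    using sums_cp sdiff by (intro suminf_ennreal_eq) auto
  finally have "\<phi> \<in> bellman_admissible M p f F"
    using \<phi>(1,2) int1 by (simp add: bellman_admissible_def)
  then have "(\<integral>\<^sup>+x. ennpowr (max (dyadic_maximal M T \<phi> x) (ennreal L)) p \<partial>M) \<le> bellman M T p f F L"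
    unfolding bellman_def by (rule SUP_upper)
  moreover have "ennreal (L powr p * (1 - \<kappa>) + \<kappa> * L powr p * Q) = (\<Sum>k. ennreal (b k * (s k - s (Suc k))))"
    using sums_b sdiff b_nonneg by (intro suminf_ennreal_eq[symmetric]) auto
  moreover have "\<dots> \<le> (\<Sum>k. ennreal (max (A k) L powr p) * ennreal (s k - s (Suc k)))"
    using b_le sdiff b_nonneg
    by (intro suminf_le) (auto simp flip: ennreal_mult intro!: ennreal_leI mult_right_mono)
  moreover have "\<dots> \<le> (\<integral>\<^sup>+x. ennpowr (max (dyadic_maximal M T \<phi> x) (ennreal L)) p \<partial>M)"
    using L p by (intro \<phi>(4)[rule_format]) auto
  ultimately show ?thesis by simp
qed

text \<open>Let \<alpha> tend to 0 in \<open>bellman_ge_geometric\<close>, where \<open>Q\<close>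
  tends to \<open>a powr p / H_fun p a\<close>. The strict inequality for \<open>F\<close> survives
  for all small \<alpha>.\<close>

lemma bellman_ge_two_parameter:
  assumes p: "1 < p" and f: "0 < f" "f \<le> L" and \<kappa>: "0 < \<kappa>" "\<kappa> < 1" "\<kappa> * L < f"
    and a: "1 < a" "a < p / (p - 1)"
    and F: "\<kappa> * (L powr p / H_fun p a) + (f - \<kappa> * L) powr p / (1 - \<kappa>) powr (p - 1) < F"
  shows "ennreal (L powr p * (1 - \<kappa>) + \<kappa> * L powr p * (a powr p / H_fun p a)) \<le> bellman M T p f F L"
proof -
  have H: "0 < H_fun p a" using p a by (intro H_fun_pos) auto
  have L: "0 < L" using f by simp
  define Q where "Q \<alpha> = \<alpha> / (1 - ((1 - \<alpha> / a) / (1 - \<alpha>)) powr p * (1 - \<alpha>))" for \<alpha>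
  have Q: "(Q \<longlongrightarrow> a powr p / H_fun p a) (at_right 0)"
    unfolding Q_def[abs_def] using a p H by (intro geometric_quotient_tendsto)
  let ?P = "\<lambda>q. \<kappa> * ((L / a) powr p * q) + (f - \<kappa> * L) powr p / (1 - \<kappa>) powr (p - 1)"
  have "?P (a powr p / H_fun p a) < F"
    using F L a by (simp add: powr_divide)
  moreover have "((\<lambda>\<alpha>. ?P (Q \<alpha>)) \<longlongrightarrow> ?P (a powr p / H_fun p a)) (at_right 0)"
    by (intro tendsto_intros Q)
  ultimately have ev1: "\<forall>\<^sub>F \<alpha> in at_right 0. ?P (Q \<alpha>) < F"
    by (rule order_tendstoD(2)[rotated])
  have ev2: "\<forall>\<^sub>F \<alpha> in at_right 0. 0 < Q \<alpha>"
    using Q H a by (intro order_tendstoD(1)[OF Q]) simp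
  have ev3: "\<forall>\<^sub>F \<alpha> in at_right (0::real). 0 < \<alpha> \<and> \<alpha> < 1"
    by (auto simp: eventually_at_right_field intro: exI[of _ 1])
  have "((\<lambda>\<alpha>. ennreal (L powr p * (1 - \<kappa>) + \<kappa> * L powr p * Q \<alpha>)) \<longlongrightarrow>
      ennreal (L powr p * (1 - \<kappa>) + \<kappa> * L powr p * (a powr p / H_fun p a))) (at_right 0)"
    by (intro tendsto_ennrealI tendsto_intros Q)
  moreover have "\<forall>\<^sub>F \<alpha> in at_right 0. ennreal (L powr p * (1 - \<kappa>) + \<kappa> * L powr p * Q \<alpha>) \<le> bellman M T p f F L"
    using ev1 ev2 ev3
  proof eventually_elim
    case (elim \<alpha>)
    then show ?case
      using p f \<kappa> a by (intro bellman_ge_geometric[where \<alpha> = \<alpha> and a = a]) (auto simp: Q_def)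
  qed
  ultimately show ?thesis
    by (rule tendsto_upperbound) simp
qed

lemma bellman_ge_trivial:
  assumes p: "1 < p" and f: "0 < f" "f \<le> L"
  shows "ennreal (L powr p) \<le> bellman M T p f (f powr p) L"
proof -
  have "(\<lambda>_. f) \<in> bellman_admissible M p f (f powr p)"
    using f by (simp add: bellman_admissible_def emeasure_space_1)
  then have "(\<integral>\<^sup>+x. ennpowr (max (dyadic_maximal M T (\<lambda>_. f) x) (ennreal L)) p \<partial>M) \<le> bellman M T p f (f powr p) L"
    unfolding bellman_def by (rule SUP_upper)
  moreover have "(\<integral>\<^sup>+x. ennreal (L powr p) \<partial>M) \<le> (\<integral>\<^sup>+x. ennpowr (max (dyadic_maximal M T (\<lambda>_. f) x) (ennreal L)) p \<partial>M)"
    using p f by (intro nn_integral_mono ennpowr_mono_ennreal) auto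
  ultimately show ?thesis
    by (simp add: emeasure_space_1)
qed

text \<open>Equality in the constraint on \<open>F\<close> is reached by letting \<open>a\<close>
  increase to \<open>z\<close>: since \<open>H_fun\<close> is strictly decreasing, each smaller
  \<open>a\<close> satisfies the strict constraint.\<close>

lemma bellman_ge_two_parameter_closed:
  assumes p: "1 < p" and f: "0 < f" "f \<le> L" and \<kappa>: "0 < \<kappa>" "\<kappa> < 1" "\<kappa> * L < f"
    and z: "1 < z" "z < p / (p - 1)"
    and F: "\<kappa> * (L powr p / H_fun p z) + (f - \<kappa> * L) powr p / (1 - \<kappa>) powr (p - 1) \<le> F"
  shows "ennreal (L powr p * (1 - \<kappa>) + \<kappa> * L powr p * (z powr p / H_fun p z)) \<le> bellman M T p f F L"
proof -
  have H: "0 < H_fun p z" using p z by (intro H_fun_pos) auto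
  have L: "0 < L" using f by simp
  have "H_fun p \<midarrow>z\<rightarrow> H_fun p z"
    using continuous_H_fun[of z p] z by (simp add: isCont_def)
  then have "(H_fun p \<longlongrightarrow> H_fun p z) (at_left z)"
    by (rule filterlim_mono) (auto simp: at_le)
  then have "((\<lambda>a. ennreal (L powr p * (1 - \<kappa>) + \<kappa> * L powr p * (a powr p / H_fun p a))) \<longlongrightarrow>
      ennreal (L powr p * (1 - \<kappa>) + \<kappa> * L powr p * (z powr p / H_fun p z))) (at_left z)"
    using z H by (intro tendsto_ennrealI tendsto_intros) auto
  moreover have "\<forall>\<^sub>F a in at_left z. 1 < a \<and> a < z"
    using z by (auto simp: eventually_at_left_field intro: exI[of _ 1])
  then have "\<forall>\<^sub>F a in at_left z.
      ennreal (L powr p * (1 - \<kappa>) + \<kappa> * L powr p * (a powr p / H_fun p a)) \<le> bellman M T p f F L"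
  proof eventually_elim
    case (elim a)
    then have "H_fun p z < H_fun p a"
      using p by (intro H_fun_strict_antimono) auto
    then have "\<kappa> * (L powr p / H_fun p a) < \<kappa> * (L powr p / H_fun p z)"
      using \<kappa> H L by (intro mult_strict_left_mono divide_strict_left_mono mult_pos_pos) auto
    then show ?case
      using F elim z p f \<kappa> by (intro bellman_ge_two_parameter) auto
  qed
  ultimately show ?thesis
    by (rule tendsto_upperbound) simp
qed

text \<open>The parameters imitate the equality case of Young's inequality, in which the maximal
  function cut off below at \<open>L\<close> is \<open>z\<close> times \<phi> everywhere. On the
  geometric layers this is arranged by taking \<open>a\<close> close to \<open>z\<close>; outside
  them \<phi> should be close to \<open>L / z\<close>.\<close>

lemma bellman_ge_small_L:
  assumes p: "1 < p" and f: "0 < f" "f \<le> L" and z: "1 < z" "z < p / (p - 1)"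
    and F: "f powr p < F" and Hz: "F * H_fun p z = p * L powr (p - 1) * f - (p - 1) * L powr p"
  shows "ennreal (F * z powr p) \<le> bellman M T p f F L"
proof -
  have H: "0 < H_fun p z" using p z by (intro H_fun_pos) auto
  have L: "0 < L" using f by simp
  have LL: "L powr p = L powr (p - 1) * L" using L by (simp add: powr_diff)
  show ?thesis
  \<comment> \<open>For \<open>L = f\<close> the value of \<kappa> used below would be 1, which the
    construction excludes. In that case every \<kappa> in (0, 1) is admissible, and \<kappa> tends
    to 1.\<close>
  proof (cases "L = f")
    case True
    have F_eq: "F = L powr p / H_fun p z"
    proof -
      have "F * H_fun p z = L powr p"
        unfolding Hz LL using True by (simp add: algebra_simps)
      then show ?thesis using H by (simp add: field_simps)
    qed
    have H1: "H_fun p z < 1" using H_fun_strict_antimono[of p 1 z] p z by simp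
    have "ennreal (L powr p * (1 - \<kappa>) + \<kappa> * L powr p * (z powr p / H_fun p z)) \<le> bellman M T p f F L"
      if \<kappa>: "0 < \<kappa>" "\<kappa> < 1" for \<kappa>
    proof (rule bellman_ge_two_parameter_closed)
      have "f - \<kappa> * L = (1 - \<kappa>) * L" using True by (simp add: algebra_simps)
      then have "(f - \<kappa> * L) powr p / (1 - \<kappa>) powr (p - 1) = (1 - \<kappa>) * L powr p"
        using \<kappa> L by (simp add: powr_mult powr_diff)
      moreover have "L powr p \<le> F"
        using F True by simp
      then have "(1 - \<kappa>) * L powr p \<le> (1 - \<kappa>) * F"
        using \<kappa> by (intro mult_left_mono) auto
      ultimately show "\<kappa> * (L powr p / H_fun p z) + (f - \<kappa> * L) powr p / (1 - \<kappa>) powr (p - 1) \<le> F"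
        unfolding F_eq[symmetric] by (simp add: algebra_simps)
    qed (use p f z \<kappa> True in auto)
    moreover have "\<forall>\<^sub>F \<kappa> in at_left (1::real). 0 < \<kappa> \<and> \<kappa> < 1"
      by (auto simp: eventually_at_left_field intro: exI[of _ 0])
    ultimately have "\<forall>\<^sub>F \<kappa> in at_left 1.
        ennreal (L powr p * (1 - \<kappa>) + \<kappa> * L powr p * (z powr p / H_fun p z)) \<le> bellman M T p f F L"
      by (auto elim!: eventually_mono)
    moreover have "((\<lambda>\<kappa>. ennreal (L powr p * (1 - \<kappa>) + \<kappa> * L powr p * (z powr p / H_fun p z))) \<longlongrightarrow>
        ennreal (L powr p * (1 - 1) + 1 * L powr p * (z powr p / H_fun p z))) (at_left 1)"
      by (intro tendsto_ennrealI tendsto_intros)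
    ultimately have "ennreal (L powr p * (1 - 1) + 1 * L powr p * (z powr p / H_fun p z)) \<le> bellman M T p f F L"
      by (intro tendsto_upperbound) auto
    then show ?thesis
      by (simp add: F_eq)
  next
    case False
    then have fL: "f < L" using f by simp
    have "f powr p * H_fun p (L / f) = F * H_fun p z"
      unfolding Hz by (rule H_fun_ratio[OF f(1) L])
    also have "\<dots> > f powr p * H_fun p z"
      using F H by (intro mult_strict_right_mono)
    finally have "H_fun p z < H_fun p (L / f)"
      using f by simp
    then have "L / f < z"
      using fL f z p by (subst (asm) H_fun_less_iff) auto
    then have Lz: "L / z < f" using f z by (simp add: field_simps)
    have LzL: "L / z < L" using z L by (simp add: divide_less_eq)
    \<comment> \<open>Determined by the total integral: average \<open>L\<close> on the set of
      measure \<kappa> and value \<open>L / z\<close> on the rest must add up to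
      \<open>f\<close>.\<close>
    define \<kappa> where "\<kappa> = (f - L / z) / (L - L / z)"
    have \<kappa>: "0 < \<kappa>" "\<kappa> < 1" using Lz LzL fL by (auto simp: \<kappa>_def)
    have "\<kappa> * (L - L / z) = f - L / z"
      using LzL by (simp add: \<kappa>_def)
    then have f_eq: "f = \<kappa> * L + (1 - \<kappa>) * (L / z)"
      by (simp add: algebra_simps diff_divide_distrib)
    have rest: "(f - \<kappa> * L) powr p / (1 - \<kappa>) powr (p - 1) = (1 - \<kappa>) * (L / z) powr p"
    proof -
      have "f - \<kappa> * L = (1 - \<kappa>) * (L / z)" using f_eq by simp
      then have "(f - \<kappa> * L) powr p = (1 - \<kappa>) powr p * (L / z) powr p"
        using \<kappa> L z by (simp only: powr_mult)
      then show ?thesis using \<kappa> by (simp add: powr_diff)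
    qed
    \<comment> \<open>After multiplication by \<open>H_fun p z\<close> the left side is linear in
      \<open>\<kappa> * L + (1 - \<kappa>) * (L / z)\<close>, which is \<open>f\<close>; the
      assumption \<open>Hz\<close> then identifies it.\<close>
    have F_eq: "\<kappa> * (L powr p / H_fun p z) + (1 - \<kappa>) * (L / z) powr p = F"
    proof -
      have "(L / z) powr p * H_fun p z = L powr p * (p / z - (p - 1))"
        using z L by (simp add: H_fun_factored powr_divide powr_diff field_simps)
      then have "(\<kappa> * (L powr p / H_fun p z) + (1 - \<kappa>) * (L / z) powr p) * H_fun p z
          = \<kappa> * L powr p + (1 - \<kappa>) * (L powr p * (p / z - (p - 1)))"
        using H by (simp add: distrib_right mult.assoc)
      also have "\<dots> = L powr (p - 1) * (p * (\<kappa> * L + (1 - \<kappa>) * (L / z)) - (p - 1) * L)"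
        unfolding LL by (simp add: algebra_simps)
      also have "\<dots> = F * H_fun p z"
        unfolding f_eq[symmetric] Hz LL by (simp add: algebra_simps)
      finally show ?thesis using H by simp
    qed
    have "ennreal (L powr p * (1 - \<kappa>) + \<kappa> * L powr p * (z powr p / H_fun p z)) \<le> bellman M T p f F L"
    proof (rule bellman_ge_two_parameter_closed)
      have "0 < (1 - \<kappa>) * (L / z)" using \<kappa> L z by simp
      then show "\<kappa> * L < f" using f_eq by linarith
    qed (use p f z \<kappa> rest F_eq in auto)
    also have "L powr p * (1 - \<kappa>) + \<kappa> * L powr p * (z powr p / H_fun p z) = F * z powr p"
      unfolding F_eq[symmetric] using z L by (simp add: powr_divide distrib_right)
    finally show ?thesis .
  qed
qed

text \<open>Most of the space carries nearly the constant \<open>f\<close> and uses up about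
  \<open>f powr p\<close> of the \<open>p\<close>-th moment. The surplus \<eta> is concentrated on a
  set of vanishing measure, where the maximal function gains a factor tending to
  \<open>p / (p - 1)\<close>. Finally \<eta> increases to \<open>F - f powr p\<close>.\<close>

lemma bellman_ge_large_L:
  assumes p: "1 < p" and f: "0 < f" and L: "p / (p - 1) * f \<le> L" and F: "f powr p < F"
  shows "ennreal (L powr p + (p / (p - 1)) powr p * (F - f powr p)) \<le> bellman M T p f F L"
proof -
  define q where "q = p / (p - 1)"
  have q: "1 < q" using p by (simp add: q_def)
  have fL: "f \<le> L"
  proof -
    have "1 * f \<le> q * f" using q f by (intro mult_right_mono) auto
    then show ?thesis using L by (simp add: q_def)
  qed
  then have Lpos: "0 < L" using f by simp
  have *: "ennreal (L powr p + q powr p * \<eta>) \<le> bellman M T p f F L" if \<eta>: "0 < \<eta>" "\<eta> < F - f powr p" for \<eta>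
  proof -
    \<comment> \<open>Chosen so that \<open>\<kappa> a * (L powr p / H_fun p a) = \<eta>\<close>,
      the limiting \<open>p\<close>-th moment on the geometric layers. It tends to 0 as
      \<open>a\<close> approaches \<open>q\<close>, because \<open>H_fun p q = 0\<close>.\<close>
    define \<kappa> where "\<kappa> a = \<eta> * H_fun p a / L powr p" for a
    have "H_fun p \<midarrow>q\<rightarrow> 0"
      using continuous_H_fun[of q p] q H_fun_conjugate[OF p] by (simp add: isCont_def flip: q_def)
    then have "(H_fun p \<longlongrightarrow> 0) (at_left q)"
      by (rule filterlim_mono) (auto simp: at_le)
    then have "(\<kappa> \<longlongrightarrow> \<eta> * 0 / L powr p) (at_left q)"
      unfolding \<kappa>_def[abs_def] using Lpos by (intro tendsto_intros) auto
    then have \<kappa>0: "(\<kappa> \<longlongrightarrow> 0) (at_left q)" by simp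
    have id: "((\<lambda>a. a) \<longlongrightarrow> q) (at_left q)"
      by (rule tendsto_ident_at)
    have ev1: "\<forall>\<^sub>F a in at_left q. 1 < a \<and> a < q"
      using q by (auto simp: eventually_at_left_field intro: exI[of _ 1])
    have ev2: "\<forall>\<^sub>F a in at_left q. \<kappa> a < 1"
      by (rule order_tendstoD(2)[OF \<kappa>0]) simp
    have "((\<lambda>a. \<kappa> a * L) \<longlongrightarrow> 0 * L) (at_left q)"
      by (intro tendsto_intros \<kappa>0)
    then have ev3: "\<forall>\<^sub>F a in at_left q. \<kappa> a * L < f"
      by (rule order_tendstoD(2)) (use f in simp)
    have "((\<lambda>a. \<eta> + (f - \<kappa> a * L) powr p / (1 - \<kappa> a) powr (p - 1)) \<longlongrightarrow>
        \<eta> + (f - 0 * L) powr p / (1 - 0) powr (p - 1)) (at_left q)"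
      using f by (intro tendsto_intros \<kappa>0) auto
    then have ev4: "\<forall>\<^sub>F a in at_left q. \<eta> + (f - \<kappa> a * L) powr p / (1 - \<kappa> a) powr (p - 1) < F"
      by (rule order_tendstoD(2)) (use \<eta> in simp)
    have "((\<lambda>a. ennreal (L powr p * (1 - \<kappa> a) + \<eta> * a powr p)) \<longlongrightarrow>
        ennreal (L powr p * (1 - 0) + \<eta> * q powr p)) (at_left q)"
      using q by (intro tendsto_ennrealI tendsto_intros \<kappa>0 id) auto
    moreover have "\<forall>\<^sub>F a in at_left q. ennreal (L powr p * (1 - \<kappa> a) + \<eta> * a powr p) \<le> bellman M T p f F L"
      using ev1 ev2 ev3 ev4
    proof eventually_elim
      case (elim a)
      have H: "0 < H_fun p a" using elim p by (intro H_fun_pos) (auto simp: q_def)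
      then have \<kappa>_pos: "0 < \<kappa> a" using \<eta> Lpos by (simp add: \<kappa>_def)
      have \<kappa>L: "\<kappa> a * L powr p * (u / H_fun p a) = \<eta> * u" "\<kappa> a * (L powr p / H_fun p a) = \<eta>" for u
        using H Lpos by (simp_all add: \<kappa>_def)
      have "ennreal (L powr p * (1 - \<kappa> a) + \<kappa> a * L powr p * (a powr p / H_fun p a)) \<le> bellman M T p f F L"
      proof (rule bellman_ge_two_parameter)
        show "\<kappa> a * (L powr p / H_fun p a) + (f - \<kappa> a * L) powr p / (1 - \<kappa> a) powr (p - 1) < F"
          unfolding \<kappa>L using elim by blast
      qed (use elim p f fL \<kappa>_pos in \<open>auto simp: q_def\<close>)
      then show ?case by (simp only: \<kappa>L)
    qed
    ultimately have "ennreal (L powr p * (1 - 0) + \<eta> * q powr p) \<le> bellman M T p f F L"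
      by (rule tendsto_upperbound) simp
    then show ?thesis by (simp add: mult.commute)
  qed
  have "\<forall>\<^sub>F \<eta> in at_left (F - f powr p). 0 < \<eta> \<and> \<eta> < F - f powr p"
    using F by (auto simp: eventually_at_left_field intro: exI[of _ 0])
  then have "\<forall>\<^sub>F \<eta> in at_left (F - f powr p). ennreal (L powr p + q powr p * \<eta>) \<le> bellman M T p f F L"
    by eventually_elim (use * in auto)
  moreover have "((\<lambda>\<eta>. ennreal (L powr p + q powr p * \<eta>)) \<longlongrightarrow> ennreal (L powr p + q powr p * (F - f powr p))) (at_left (F - f powr p))"
    by (intro tendsto_ennrealI tendsto_intros tendsto_ident_at)
  ultimately show ?thesis
    unfolding q_def[symmetric] by (intro tendsto_upperbound) auto
qed

end

section \<open>Upper bound\<close>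

text \<open>Young's inequality for \<open>x * t\<close> and \<open>m powr (p - 1) / t\<close>, where
  \<open>t\<close> is tuned so that equality holds at \<open>m = z * x\<close>.\<close>

lemma young_powr:
  fixes p x m z :: real
  assumes "1 < p" "0 \<le> x" "0 < m" "0 < z"
  shows "x * (p / (p - 1) * m powr (p - 1)) \<le> z powr (p - 1) / (p - 1) * x powr p + m powr p / z"
proof -
  define q where "q = p / (p - 1)"
  have q: "1 < q" "1 / p + 1 / q = 1" "(p - 1) * q = p"
    using assms by (auto simp: q_def field_simps)
  define t where "t = z powr ((p - 1) / p)"
  have t: "0 < t" "t powr p = z powr (p - 1)" "t powr q = z"
    using assms by (simp_all add: t_def powr_powr q_def)
  have "(x * t) * (m powr (p - 1) / t) \<le> (x * t) powr p / p + (m powr (p - 1) / t) powr q / q"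
    using assms q t by (intro Youngs_inequality) auto
  also have "(x * t) * (m powr (p - 1) / t) = x * m powr (p - 1)"
    using t by simp
  also have "(x * t) powr p = x powr p * z powr (p - 1)"
    using t assms by (simp add: powr_mult)
  also have "(m powr (p - 1) / t) powr q = m powr p / z"
    using t assms q by (simp add: powr_divide powr_powr)
  finally have "q * (x * m powr (p - 1)) \<le> q * (x powr p * z powr (p - 1) / p + m powr p / z / q)"
    using q by (intro mult_left_mono) auto
  also have "\<dots> = q / p * (x powr p * z powr (p - 1)) + m powr p / z"
    using q by (simp add: distrib_left)
  also have "q / p = 1 / (p - 1)"
    using assms by (simp add: q_def)
  finally show ?thesis
    by (simp add: q_def mult_ac)
qed

text \<open>The case \<open>z = 1\<close> of \<open>young_powr\<close>; it says that the graph of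
  the \<open>p\<close>-th power lies above its tangent at \<open>m\<close>.\<close>

lemma powr_tangent_le:
  fixes p x m :: real
  assumes "1 < p" "0 \<le> x" "0 < m"
  shows "p * (x * m powr (p - 1)) \<le> x powr p + (p - 1) * m powr p"
proof -
  have "(p - 1) * (x * (p / (p - 1) * m powr (p - 1))) \<le> (p - 1) * (1 / (p - 1) * x powr p + m powr p)"
    using assms young_powr[of p x m 1] by (intro mult_left_mono) auto
  also have "\<dots> = x powr p + (p - 1) * m powr p"
    using assms by (simp add: distrib_left)
  also have "(p - 1) * (x * (p / (p - 1) * m powr (p - 1))) = p * (x * m powr (p - 1))"
    using assms by simp
  finally show ?thesis .
qed

lemma nn_integral_powr_Ioo:
  fixes p L y :: real
  assumes "0 < p" "0 < L" "L \<le> y"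
  shows "(\<integral>\<^sup>+l. ennreal (p * l powr (p - 1)) * indicator {L<..<y} l \<partial>lborel) = ennreal (y powr p - L powr p)"
proof -
  have "(\<integral>\<^sup>+l. ennreal (p * l powr (p - 1)) * indicator {L<..<y} l \<partial>lborel) =
      (\<integral>\<^sup>+l. ennreal (p * l powr (p - 1)) * indicator {L..y} l \<partial>lborel)"
  proof (rule nn_integral_cong_AE)
    show "AE l in lborel. ennreal (p * l powr (p - 1)) * indicator {L<..<y} l = ennreal (p * l powr (p - 1)) * indicator {L..y} l"
      using AE_lborel_singleton[of L] AE_lborel_singleton[of y]
      by eventually_elim (auto split: split_indicator)
  qed
  also have "\<dots> = ennreal (y powr p - L powr p)"
  proof (rule nn_integral_FTC_Icc)
    fix l assume "l \<in> {L..y}"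
    then show "((\<lambda>l. l powr p) has_real_derivative p * l powr (p - 1)) (at l)"
      using assms by (auto intro!: derivative_eq_intros)
  qed (use assms in auto)
  finally show ?thesis .
qed

section \<open>From weak type estimates to integral inequalities\<close>

context prob_space
begin

text \<open>Layer cake: \<open>m x powr p - L powr p\<close> is the integral of
  \<open>p * l powr (p - 1)\<close> over \<open>L < l < m x\<close>. After swapping the integrals,
  the weak type bound trades one factor \<open>l\<close> for \<phi>; swapping back and integrating
  \<open>p * l powr (p - 2)\<close> gives the factor \<open>p / (p - 1)\<close> and the exponent
  \<open>p - 1\<close>.\<close>

lemma weak_type_imp_strong_type:
  fixes m \<phi> :: "'a \<Rightarrow> real"
  assumes p: "1 < p" and L: "0 < L"
    and [measurable]: "m \<in> borel_measurable M" "\<phi> \<in> borel_measurable M"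
    and m: "\<And>x. x \<in> space M \<Longrightarrow> L \<le> m x" and \<phi>: "\<And>x. x \<in> space M \<Longrightarrow> 0 \<le> \<phi> x"
    and weak: "\<And>l. L \<le> l \<Longrightarrow> ennreal l * emeasure M {x \<in> space M. l < m x}
        \<le> (\<integral>\<^sup>+x. ennreal (\<phi> x) * indicator {x \<in> space M. l < m x} x \<partial>M)"
  shows "(\<integral>\<^sup>+x. ennreal (m x powr p - L powr p) \<partial>M)
    \<le> (\<integral>\<^sup>+x. ennreal (\<phi> x * (p / (p - 1) * (m x powr (p - 1) - L powr (p - 1)))) \<partial>M)"
proof -
  interpret P: pair_sigma_finite M lborel ..
  define I :: "'a \<Rightarrow> real \<Rightarrow> ennreal" where "I x l = (if L < l \<and> l < m x then 1 else 0)" for x l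
  have I_meas[measurable]: "(\<lambda>(x, l). I x l) \<in> borel_measurable (M \<Otimes>\<^sub>M lborel)"
    unfolding I_def[abs_def] by measurable
  have I_ind: "I x l = indicator {L<..<m x} l" for x l
    by (auto simp: I_def split: split_indicator)
  have "(\<integral>\<^sup>+x. ennreal (m x powr p - L powr p) \<partial>M)
      = (\<integral>\<^sup>+x. (\<integral>\<^sup>+l. ennreal (p * l powr (p - 1)) * I x l \<partial>lborel) \<partial>M)"
    using p L m by (intro nn_integral_cong) (simp add: I_ind nn_integral_powr_Ioo)
  also have "\<dots> = (\<integral>\<^sup>+l. (\<integral>\<^sup>+x. ennreal (p * l powr (p - 1)) * I x l \<partial>M) \<partial>lborel)"
    by (intro P.Fubini'[symmetric]) measurable
  also have "\<dots> \<le> (\<integral>\<^sup>+l. (\<integral>\<^sup>+x. ennreal (\<phi> x) * (ennreal (p * l powr (p - 2)) * I x l) \<partial>M) \<partial>lborel)"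
  proof (rule nn_integral_mono)
    fix l :: real
    show "(\<integral>\<^sup>+x. ennreal (p * l powr (p - 1)) * I x l \<partial>M)
        \<le> (\<integral>\<^sup>+x. ennreal (\<phi> x) * (ennreal (p * l powr (p - 2)) * I x l) \<partial>M)"
    proof (cases "L < l")
      case True
      have I_l: "I x l = indicator {x \<in> space M. l < m x} x" if "x \<in> space M" for x
        using True that by (auto simp: I_def split: split_indicator)
      have pl: "ennreal (p * l powr (p - 1)) = ennreal (p * l powr (p - 2)) * ennreal l"
      proof -
        have "l powr (p - 1) = l powr (p - 2) * l"
          using True L powr_add[of l "p - 2" 1] by simp
        then show ?thesis using p True L by (simp add: ennreal_mult'[symmetric] mult.assoc)
      qed
      have "(\<integral>\<^sup>+x. ennreal (p * l powr (p - 1)) * I x l \<partial>M)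
          = (\<integral>\<^sup>+x. ennreal (p * l powr (p - 1)) * indicator {x \<in> space M. l < m x} x \<partial>M)"
        by (intro nn_integral_cong) (simp add: I_l)
      also have "\<dots> = ennreal (p * l powr (p - 2)) * (ennreal l * emeasure M {x \<in> space M. l < m x})"
        by (simp add: nn_integral_cmult pl mult.assoc)
      also have "\<dots> \<le> ennreal (p * l powr (p - 2)) * (\<integral>\<^sup>+x. ennreal (\<phi> x) * indicator {x \<in> space M. l < m x} x \<partial>M)"
        using True by (intro mult_left_mono weak) auto
      also have "\<dots> = (\<integral>\<^sup>+x. ennreal (p * l powr (p - 2)) * (ennreal (\<phi> x) * indicator {x \<in> space M. l < m x} x) \<partial>M)"
        by (intro nn_integral_cmult[symmetric]) measurable
      also have "\<dots> = (\<integral>\<^sup>+x. ennreal (\<phi> x) * (ennreal (p * l powr (p - 2)) * I x l) \<partial>M)"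
        by (intro nn_integral_cong) (simp add: I_l mult_ac)
      finally show ?thesis .
    qed (simp add: I_def)
  qed
  also have "\<dots> = (\<integral>\<^sup>+x. (\<integral>\<^sup>+l. ennreal (\<phi> x) * (ennreal (p * l powr (p - 2)) * I x l) \<partial>lborel) \<partial>M)"
    by (intro P.Fubini') measurable
  also have "\<dots> = (\<integral>\<^sup>+x. ennreal (\<phi> x * (p / (p - 1) * (m x powr (p - 1) - L powr (p - 1)))) \<partial>M)"
  proof (intro nn_integral_cong)
    fix x assume x: "x \<in> space M"
    define q where "q = p / (p - 1)"
    have q: "0 < q" "p = q * (p - 1)" using p by (auto simp: q_def)
    have "(\<integral>\<^sup>+l. ennreal (\<phi> x) * (ennreal (p * l powr (p - 2)) * I x l) \<partial>lborel)
        = (\<integral>\<^sup>+l. (ennreal (\<phi> x) * ennreal q) * (ennreal ((p - 1) * l powr (p - 1 - 1)) * indicator {L<..<m x} l) \<partial>lborel)"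
    proof (intro nn_integral_cong)
      fix l :: real
      have "ennreal (p * l powr (p - 2)) = ennreal q * ennreal ((p - 1) * l powr (p - 1 - 1))"
        using q p by (subst ennreal_mult'[symmetric]) (simp_all add: mult.assoc[symmetric] flip: q(2))
      then show "ennreal (\<phi> x) * (ennreal (p * l powr (p - 2)) * I x l)
          = (ennreal (\<phi> x) * ennreal q) * (ennreal ((p - 1) * l powr (p - 1 - 1)) * indicator {L<..<m x} l)"
        by (simp add: I_ind mult.assoc)
    qed
    also have "\<dots> = ennreal (\<phi> x) * ennreal q * ennreal (m x powr (p - 1) - L powr (p - 1))"
      using p L m[OF x] nn_integral_powr_Ioo[of "p - 1" L "m x"] by (subst nn_integral_cmult) simp_all
    also have "\<dots> = ennreal (\<phi> x * (q * (m x powr (p - 1) - L powr (p - 1))))"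
      using \<phi>[OF x] q p L m[OF x] by (simp add: ennreal_mult mult.assoc powr_mono2)
    finally show "(\<integral>\<^sup>+l. ennreal (\<phi> x) * (ennreal (p * l powr (p - 2)) * I x l) \<partial>lborel)
      = ennreal (\<phi> x * (p / (p - 1) * (m x powr (p - 1) - L powr (p - 1))))"
      by (simp add: q_def)
  qed
  finally show ?thesis .
qed

text \<open>The upper bound \<open>N\<close> makes all integrals finite, so the multiple of the
  integral of \<open>m x powr p\<close> that Young's inequality puts on the right can be absorbed on
  the left.\<close>

lemma weak_type_imp_integral_le:
  fixes m \<phi> :: "'a \<Rightarrow> real"
  assumes p: "1 < p" and L: "0 < L" and f: "0 < f"
    and [measurable]: "m \<in> borel_measurable M" "\<phi> \<in> borel_measurable M"
    and m: "\<And>x. x \<in> space M \<Longrightarrow> L \<le> m x" "\<And>x. x \<in> space M \<Longrightarrow> m x \<le> N"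
    and \<phi>: "\<And>x. x \<in> space M \<Longrightarrow> 0 \<le> \<phi> x"
    and weak: "\<And>l. L \<le> l \<Longrightarrow> ennreal l * emeasure M {x \<in> space M. l < m x}
        \<le> (\<integral>\<^sup>+x. ennreal (\<phi> x) * indicator {x \<in> space M. l < m x} x \<partial>M)"
    and int: "has_bochner_integral M \<phi> f" "has_bochner_integral M (\<lambda>x. \<phi> x powr p) F"
  shows "integrable M (\<lambda>x. m x powr p)"
    and "1 < z \<Longrightarrow> (1 - 1 / z) * (\<integral>x. m x powr p \<partial>M)
      \<le> L powr p - p / (p - 1) * L powr (p - 1) * f + z powr (p - 1) / (p - 1) * F"
    and "p / (p - 1) * f \<le> L \<Longrightarrow> (\<integral>x. m x powr p \<partial>M) \<le> L powr p + (p / (p - 1)) powr p * (F - f powr p)"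
proof -
  define q where "q = p / (p - 1)"
  have q: "1 < q" "p / q = p - 1" "1 / q = 1 - 1 / p" "p * q = p + q" "q / p = 1 / (p - 1)"
    using p by (auto simp: q_def field_simps)
  note [simp] = prob_space
  have i\<phi>[intro, simp]: "integrable M \<phi>" "integrable M (\<lambda>x. \<phi> x powr p)"
    and I\<phi>: "(\<integral>x. \<phi> x \<partial>M) = f" "(\<integral>x. \<phi> x powr p \<partial>M) = F"
    using int by (auto simp: has_bochner_integral_iff)
  show im: "integrable M (\<lambda>x. m x powr p)"
    using p L m by (intro integrable_const_bound[where B = "N powr p"] AE_I2) (auto intro!: powr_mono2 order.trans[OF _ m(1)])
  have i\<phi>m: "integrable M (\<lambda>x. \<phi> x * m x powr (p - 1))"
  proof (rule Bochner_Integration.integrable_bound)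
    show "integrable M (\<lambda>x. N powr (p - 1) * \<phi> x)" by simp
    show "AE x in M. norm (\<phi> x * m x powr (p - 1)) \<le> norm (N powr (p - 1) * \<phi> x)"
    proof (rule AE_I2)
      fix x assume x: "x \<in> space M"
      have "m x powr (p - 1) \<le> N powr (p - 1)"
        using p L m[OF x] by (intro powr_mono2) auto
      then show "norm (\<phi> x * m x powr (p - 1)) \<le> norm (N powr (p - 1) * \<phi> x)"
        using \<phi>[OF x] by (simp add: abs_mult mult.commute mult_left_mono)
    qed
  qed simp
  define D where "D = (\<integral>x. m x powr p \<partial>M) - L powr p"
  have strong: "D \<le> (\<integral>x. \<phi> x * (q * (m x powr (p - 1) - L powr (p - 1))) \<partial>M)"
  proof -
    have "ennreal (\<integral>x. m x powr p - L powr p \<partial>M) = (\<integral>\<^sup>+x. ennreal (m x powr p - L powr p) \<partial>M)"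
      using im p L m by (intro nn_integral_eq_integral[symmetric] AE_I2) (auto intro!: powr_mono2)
    also have "\<dots> \<le> (\<integral>\<^sup>+x. ennreal (\<phi> x * (q * (m x powr (p - 1) - L powr (p - 1)))) \<partial>M)"
      unfolding q_def using p L m \<phi> weak by (intro weak_type_imp_strong_type) auto
    also have "\<dots> = ennreal (\<integral>x. \<phi> x * (q * (m x powr (p - 1) - L powr (p - 1))) \<partial>M)"
    proof (rule nn_integral_eq_integral)
      have "integrable M (\<lambda>x. q * (\<phi> x * m x powr (p - 1)) - q * L powr (p - 1) * \<phi> x)"
        using i\<phi>m by simp
      then show "integrable M (\<lambda>x. \<phi> x * (q * (m x powr (p - 1) - L powr (p - 1))))"
        by (simp add: algebra_simps)
      show "AE x in M. 0 \<le> \<phi> x * (q * (m x powr (p - 1) - L powr (p - 1)))"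
        using p L m q \<phi> by (intro AE_I2 mult_nonneg_nonneg) (auto intro!: powr_mono2)
    qed
    finally have "(\<integral>x. m x powr p - L powr p \<partial>M) \<le> (\<integral>x. \<phi> x * (q * (m x powr (p - 1) - L powr (p - 1))) \<partial>M)"
      using p L m q \<phi> by (subst (asm) ennreal_le_iff) (auto intro!: integral_nonneg_AE AE_I2 mult_nonneg_nonneg powr_mono2)
    then show ?thesis
      using im by (simp add: D_def)
  qed
  show "(1 - 1 / z) * (\<integral>x. m x powr p \<partial>M)
      \<le> L powr p - p / (p - 1) * L powr (p - 1) * f + z powr (p - 1) / (p - 1) * F" if z: "1 < z"
  proof -
    have "(\<integral>x. \<phi> x * (q * (m x powr (p - 1) - L powr (p - 1))) \<partial>M)
        \<le> (\<integral>x. z powr (p - 1) / (p - 1) * \<phi> x powr p + m x powr p / z - q * L powr (p - 1) * \<phi> x \<partial>M)"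
    proof (rule integral_mono_AE)
      have "integrable M (\<lambda>x. q * (\<phi> x * m x powr (p - 1)) - q * L powr (p - 1) * \<phi> x)"
        using i\<phi>m by simp
      then show "integrable M (\<lambda>x. \<phi> x * (q * (m x powr (p - 1) - L powr (p - 1))))"
        by (simp add: algebra_simps)
      show "AE x in M. \<phi> x * (q * (m x powr (p - 1) - L powr (p - 1)))
          \<le> z powr (p - 1) / (p - 1) * \<phi> x powr p + m x powr p / z - q * L powr (p - 1) * \<phi> x"
      proof (rule AE_I2)
        fix x assume x: "x \<in> space M"
        have "\<phi> x * (q * m x powr (p - 1)) \<le> z powr (p - 1) / (p - 1) * \<phi> x powr p + m x powr p / z"
          unfolding q_def using p \<phi>[OF x] m[OF x] L z by (intro young_powr) auto
        then show "\<phi> x * (q * (m x powr (p - 1) - L powr (p - 1)))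
          \<le> z powr (p - 1) / (p - 1) * \<phi> x powr p + m x powr p / z - q * L powr (p - 1) * \<phi> x"
          by (simp add: right_diff_distrib mult_ac)
      qed
    qed (use im in auto)
    also have "\<dots> = z powr (p - 1) / (p - 1) * F + (\<integral>x. m x powr p \<partial>M) / z - q * L powr (p - 1) * f"
      using im by (simp add: I\<phi>)
    finally show ?thesis
      using strong by (simp add: D_def q_def left_diff_distrib)
  qed
  show "(\<integral>x. m x powr p \<partial>M) \<le> L powr p + (p / (p - 1)) powr p * (F - f powr p)" if fL: "p / (p - 1) * f \<le> L"
  proof -
    define E where "E = {x \<in> space M. L < m x}"
    have E[measurable]: "E \<in> sets M" unfolding E_def by measurable
    define k where "k = measure M E"
    define B where "B = (\<integral>x. \<phi> x * indicator E x \<partial>M)"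
    \<comment> \<open>The threshold for \<open>L\<close> at which the two cases of the theorem meet.
      Powers of \<open>q\<close> times powers of \<open>f\<close> become powers of \<open>u\<close>,
      directly comparable with those of \<open>L\<close>.\<close>
    define u where "u = q * f"
    have u: "0 < u" "u \<le> L" using q(1) f fL by (simp_all add: u_def flip: q_def)
    have i\<phi>E: "integrable M (\<lambda>x. \<phi> x * indicator E x)"
      by (rule integrable_real_mult_indicator) simp_all
    have k: "0 \<le> k" by (simp add: k_def)
    have kB: "L * k \<le> B"
    proof -
      have "ennreal (L * k) = ennreal L * emeasure M {x \<in> space M. L < m x}"
        using L by (simp add: k_def E_def emeasure_eq_measure ennreal_mult)
      also have "\<dots> \<le> (\<integral>\<^sup>+x. ennreal (\<phi> x) * indicator {x \<in> space M. L < m x} x \<partial>M)"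
        by (rule weak) simp
      also have "\<dots> = (\<integral>\<^sup>+x. ennreal (\<phi> x * indicator E x) \<partial>M)"
        by (intro nn_integral_cong) (auto simp: E_def split: split_indicator)
      also have "\<dots> = ennreal B"
        unfolding B_def using i\<phi>E \<phi> by (intro nn_integral_eq_integral AE_I2) auto
      finally show ?thesis
        using \<phi> by (subst (asm) ennreal_le_iff) (auto simp: B_def intro!: integral_nonneg_AE AE_I2)
    qed
    \<comment> \<open>One expression for both majorants. On \<open>E\<close> the terms in
      \<open>f\<close> and the lone \<open>L powr p\<close> cancel, leaving Young's bound with
      \<open>z = q\<close>. Off \<open>E\<close>, where \<open>m = L\<close>, what remains is
      \<open>q powr p / p\<close> times the nonnegative gap between the \<open>p\<close>-th power
      and its tangent at \<open>f\<close>.\<close>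
    define R where "R x = q powr p / p * (\<phi> x powr p - p * f powr (p - 1) * \<phi> x + (p - 1) * f powr p
        + (p * f powr (p - 1) * (\<phi> x * indicator E x) - (p - 1) * f powr p * indicator E x))
        + 1 / q * (m x powr p - L powr p) + L powr p / q * indicator E x
        - q * L powr (p - 1) * (\<phi> x * indicator E x)" for x
    have qp: "q powr (p - 1) / (p - 1) = q powr p / p"
    proof -
      have "q powr p = q powr (p - 1) * q" using q by (simp add: powr_diff)
      then have "q powr p / p = q powr (p - 1) * (q / p)" by simp
      then show ?thesis unfolding q(5) by simp
    qed
    have "(\<integral>x. \<phi> x * (q * (m x powr (p - 1) - L powr (p - 1))) \<partial>M) \<le> (\<integral>x. R x \<partial>M)"
    proof (rule integral_mono_AE)
      have "integrable M (\<lambda>x. q * (\<phi> x * m x powr (p - 1)) - q * L powr (p - 1) * \<phi> x)"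
        using i\<phi>m by simp
      then show "integrable M (\<lambda>x. \<phi> x * (q * (m x powr (p - 1) - L powr (p - 1))))"
        by (simp add: algebra_simps)
      show "integrable M R"
        unfolding R_def[abs_def] using im i\<phi>E by (auto simp: emeasure_eq_measure)
      show "AE x in M. \<phi> x * (q * (m x powr (p - 1) - L powr (p - 1))) \<le> R x"
      proof (rule AE_I2)
        fix x assume x: "x \<in> space M"
        show "\<phi> x * (q * (m x powr (p - 1) - L powr (p - 1))) \<le> R x"
        proof (cases "x \<in> E")
          case True
          have "\<phi> x * (q * m x powr (p - 1)) \<le> q powr (p - 1) / (p - 1) * \<phi> x powr p + m x powr p / q"
            unfolding q_def using p \<phi>[OF x] m[OF x] L by (intro young_powr) auto
          then have "\<phi> x * (q * m x powr (p - 1)) \<le> q powr p / p * \<phi> x powr p + m x powr p / q"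
            by (simp only: qp)
          then show ?thesis
            using True by (simp add: R_def algebra_simps diff_divide_distrib)
        next
          case False
          have "0 \<le> \<phi> x powr p - p * f powr (p - 1) * \<phi> x + (p - 1) * f powr p"
            using powr_tangent_le[of p "\<phi> x" f] p \<phi>[OF x] f by (simp add: algebra_simps)
          then have "0 \<le> q powr p / p * (\<phi> x powr p - p * f powr (p - 1) * \<phi> x + (p - 1) * f powr p)"
            using p by (intro mult_nonneg_nonneg) auto
          moreover have "m x = L"
            using False x m[OF x] by (auto simp: E_def)
          ultimately show ?thesis
            using False by (simp add: R_def)
        qed
      qed
    qed
    also have "(\<integral>x. R x \<partial>M) = q powr p / p * (F - p * f powr (p - 1) * f + (p - 1) * f powr p
        + (p * f powr (p - 1) * B - (p - 1) * f powr p * k)) + 1 / q * D + L powr p / q * k - q * L powr (p - 1) * B"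
      unfolding R_def[abs_def] B_def D_def k_def using im i\<phi>E
      by (simp add: I\<phi> emeasure_eq_measure)
    also have "F - p * f powr (p - 1) * f + (p - 1) * f powr p = F - f powr p"
      using f by (simp add: powr_diff algebra_simps)
    finally have "D \<le> q powr p / p * (F - f powr p + (p * f powr (p - 1) * B - (p - 1) * f powr p * k))
        + (1 - 1 / p) * D + L powr p / q * k - q * L powr (p - 1) * B"
      using strong q(3) by simp
    \<comment> \<open>Absorbing \<open>(1 - 1 / p) * D\<close> on the left leaves
      \<open>D / p\<close>.\<close>
    then have "p * (D / p) \<le> p * (q powr p / p * (F - f powr p + (p * f powr (p - 1) * B - (p - 1) * f powr p * k))
        + L powr p / q * k - q * L powr (p - 1) * B)"
      using p by (intro mult_left_mono) (auto simp: left_diff_distrib)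
    also have "\<dots> = q powr p * (F - f powr p) + (p * (q powr p * f powr (p - 1)) * B - (p - 1) * (q powr p * f powr p) * k)
        + (p / q) * L powr p * k - p * q * L powr (p - 1) * B"
      using p by (simp add: algebra_simps)
    also have "q powr p * f powr (p - 1) = q * u powr (p - 1)"
      using q f by (simp add: u_def powr_mult powr_diff)
    also have "q powr p * f powr p = u powr p"
      using q f by (simp add: u_def powr_mult)
    finally have "D \<le> q powr p * (F - f powr p) + (p * (q * u powr (p - 1)) * B - (p - 1) * u powr p * k)
        + (p / q) * L powr p * k - p * q * L powr (p - 1) * B"
      using p by simp
    then have D_le: "D \<le> q powr p * (F - f powr p) + ((p - 1) * (L powr p - u powr p) * k - p * q * (L powr (p - 1) - u powr (p - 1)) * B)"
      unfolding q(2) by (simp add: algebra_simps)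
    have uL: "u powr (p - 1) \<le> L powr (p - 1)"
      using u p by (intro powr_mono2) auto
    \<comment> \<open>Together with \<open>L * k \<le> B\<close> this shows that the terms in
      \<open>k\<close> and \<open>B\<close> in \<open>D_le\<close> add up to at most 0. It follows
      from the tangent of the \<open>p\<close>-th power at \<open>u\<close>, evaluated at
      \<open>L\<close>, and from \<open>u \<le> L\<close>.\<close>
    have "(p - 1) * (L powr p - u powr p) \<le> p * q * (L powr (p - 1) - u powr (p - 1)) * L"
    proof -
      have 1: "p * (L * u powr (p - 1)) \<le> L powr p + (p - 1) * u powr p"
        using p L u by (intro powr_tangent_le) auto
      have LL: "L powr p = L * L powr (p - 1)" using L by (simp add: powr_diff)
      have "q * (L * u powr (p - 1)) \<le> q * L powr p"
        unfolding LL using uL q L by (intro mult_left_mono) auto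
      with 1 have "(p + q) * (L * u powr (p - 1)) \<le> L powr p + (p - 1) * u powr p + q * L powr p"
        by (simp add: distrib_right)
      moreover have "p * q * (L powr (p - 1) - u powr (p - 1)) * L = (p + q) * L powr p - (p + q) * (L * u powr (p - 1))"
        unfolding q(4) LL by (simp add: algebra_simps)
      ultimately show ?thesis
        by (simp add: algebra_simps)
    qed
    then have "(p - 1) * (L powr p - u powr p) * k \<le> p * q * (L powr (p - 1) - u powr (p - 1)) * L * k"
      using k by (rule mult_right_mono)
    also have "\<dots> \<le> p * q * (L powr (p - 1) - u powr (p - 1)) * B"
      using kB uL p q by (simp only: mult.assoc) (intro mult_left_mono, auto)
    finally have "D \<le> q powr p * (F - f powr p)"
      using D_le by simp
    then show ?thesis
      by (simp add: D_def q_def)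
  qed
qed

end

section \<open>Weak type estimate and truncation of the dyadic maximal function\<close>

context tree_prob_space
begin

text \<open>The index set of the supremum depends on the point. Indicators move this dependence into
  the terms, leaving a supremum over the countable set \<open>T\<close>.\<close>

lemma borel_measurable_dyadic_maximal [measurable]: "dyadic_maximal M T \<phi> \<in> borel_measurable M"
proof -
  define v where "v I = (\<integral>\<^sup>+y\<in>I. ennreal \<bar>\<phi> y\<bar> \<partial>M) / emeasure M I" for I
  have "dyadic_maximal M T \<phi> x = (SUP I\<in>T. v I * indicator I x)" for x
    unfolding dyadic_maximal_def v_def[symmetric]
  proof (rule antisym)
    show "(SUP I\<in>{I \<in> T. x \<in> I}. v I) \<le> (SUP I\<in>T. v I * indicator I x)"
      by (intro SUP_least SUP_upper2) auto
    show "(SUP I\<in>T. v I * indicator I x) \<le> (SUP I\<in>{I \<in> T. x \<in> I}. v I)"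
      by (intro SUP_least) (auto split: split_indicator intro!: SUP_upper)
  qed
  then have "dyadic_maximal M T \<phi> = (\<lambda>x. SUP I\<in>T. v I * indicator I x)" by blast
  moreover have "(\<lambda>x. v I * indicator I x) \<in> borel_measurable M" if "I \<in> T" for I
    using in_sets[OF that] by measurable
  ultimately show ?thesis
    using countable_T by simp
qed

text \<open>The superlevel set is the union of all cells whose average exceeds \<open>l\<close>,
  hence of the maximal ones, which are disjoint. Taking the integral of the absolute value of \<phi>
  as a measure, the bound on each cell adds up.\<close>

lemma dyadic_maximal_weak_type:
  assumes [measurable]: "\<phi> \<in> borel_measurable M"
  shows "ennreal l * emeasure M {x \<in> space M. ennreal l < dyadic_maximal M T \<phi> x}
    \<le> (\<integral>\<^sup>+x. ennreal \<bar>\<phi> x\<bar> * indicator {x \<in> space M. ennreal l < dyadic_maximal M T \<phi> x} x \<partial>M)"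
proof -
  let ?N = "density M (\<lambda>x. ennreal \<bar>\<phi> x\<bar>)"
  define v where "v I = (\<integral>\<^sup>+y\<in>I. ennreal \<bar>\<phi> y\<bar> \<partial>M) / emeasure M I" for I
  define \<B> where "\<B> = {I \<in> T. ennreal l < v I}"
  have "x \<in> space M" if "x \<in> I" "I \<in> T" for x I
    using that sets.sets_into_space[OF in_sets] by blast
  then have E: "{x \<in> space M. ennreal l < dyadic_maximal M T \<phi> x} = \<Union>\<B>"
    unfolding dyadic_maximal_def v_def[symmetric] \<B>_def by (auto simp: less_SUP_iff)
  have "\<B> \<subseteq> T" by (auto simp: \<B>_def)
  then obtain \<F> where F: "\<F> \<subseteq> \<B>" "disjoint \<F>" "\<Union>\<F> = \<Union>\<B>"
    by (rule exists_maximal_cells)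
  have "ennreal l * emeasure M (\<Union>\<F>) \<le> emeasure ?N (\<Union>\<F>)"
  proof (rule emeasure_Union_cmult_le)
    have "\<F> \<subseteq> T" using F(1) \<open>\<B> \<subseteq> T\<close> by blast
    then show "countable \<F>" "\<F> \<subseteq> sets M"
      using countable_T T_sets countable_subset by blast+
    show "ennreal l * emeasure M I \<le> emeasure ?N I" if "I \<in> \<F>" for I
    proof -
      have I: "I \<in> T" "ennreal l \<le> v I"
        using that F(1) by (auto simp: \<B>_def)
      note [measurable] = in_sets[OF I(1)]
      have "ennreal l * emeasure M I \<le> v I * emeasure M I"
        by (intro mult_right_mono I) simp
      also have "\<dots> = (\<integral>\<^sup>+y\<in>I. ennreal \<bar>\<phi> y\<bar> \<partial>M)"
        using T_pos[OF I(1)] unfolding v_def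
        by (simp add: ennreal_divide_times ennreal_mult_divide_eq emeasure_eq_measure)
      also have "\<dots> = emeasure ?N I"
        by (simp add: emeasure_density)
      finally show ?thesis .
    qed
  qed (use F in auto)
  moreover have "\<Union>\<B> \<in> sets M"
    unfolding E[symmetric] by measurable
  ultimately show ?thesis
    unfolding E F(3) by (simp add: emeasure_density)
qed

text \<open>The cap \<open>N\<close> makes the function bounded and the conversion to
  \<open>real\<close> harmless at points where the maximal function is infinite.\<close>

definition truncated_maximal :: "('a \<Rightarrow> real) \<Rightarrow> real \<Rightarrow> real \<Rightarrow> 'a \<Rightarrow> real" where
  "truncated_maximal \<phi> L N x = enn2real (min (max (dyadic_maximal M T \<phi> x) (ennreal L)) (ennreal N))"

lemma truncated_maximal_infinite:
  assumes "dyadic_maximal M T \<phi> x = \<infinity>" "0 \<le> N"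
  shows "truncated_maximal \<phi> L N x = N"
  using assms by (simp add: truncated_maximal_def max_def min_def top_unique)

lemma truncated_maximal_finite:
  assumes "dyadic_maximal M T \<phi> x = ennreal r" "0 \<le> r" "0 \<le> L" "L \<le> N"
  shows "truncated_maximal \<phi> L N x = min (max r L) N"
  using assms by (simp add: truncated_maximal_def max_def min_def ennreal_le_iff)

lemma dyadic_maximal_cases:
  obtains "dyadic_maximal M T \<phi> x = \<infinity>" | r where "0 \<le> r" "dyadic_maximal M T \<phi> x = ennreal r"
  by (cases "dyadic_maximal M T \<phi> x") auto

lemma truncated_maximal_bounds:
  assumes "0 \<le> L" "L \<le> N"
  shows "L \<le> truncated_maximal \<phi> L N x" "truncated_maximal \<phi> L N x \<le> N"
proof -
  have "L \<le> truncated_maximal \<phi> L N x \<and> truncated_maximal \<phi> L N x \<le> N"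
    by (cases \<phi> x rule: dyadic_maximal_cases)
      (use assms in \<open>auto simp: truncated_maximal_infinite truncated_maximal_finite\<close>)
  then show "L \<le> truncated_maximal \<phi> L N x" "truncated_maximal \<phi> L N x \<le> N" by auto
qed

lemma less_truncated_maximal_iff:
  assumes "0 \<le> L" "L \<le> N" "L \<le> l"
  shows "l < truncated_maximal \<phi> L N x \<longleftrightarrow> l < N \<and> ennreal l < dyadic_maximal M T \<phi> x"
  by (cases \<phi> x rule: dyadic_maximal_cases)
    (use assms in \<open>auto simp: truncated_maximal_infinite truncated_maximal_finite ennreal_less_iff\<close>)

text \<open>Where the maximal function is a finite \<open>r\<close>, any cap with
  \<open>n \<ge> r\<close> already gives equality. Where it is infinite, the truncations equal their
  caps, whose \<open>p\<close>-th powers are unbounded.\<close>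

lemma ennpowr_le_SUP_truncated:
  assumes "1 \<le> p" "0 \<le> L"
  shows "ennpowr (max (dyadic_maximal M T \<phi> x) (ennreal L)) p
    \<le> (SUP n::nat. ennreal (truncated_maximal \<phi> L (L + n) x powr p))"
proof (cases \<phi> x rule: dyadic_maximal_cases)
  case 1
  have "(SUP n::nat. ennreal (truncated_maximal \<phi> L (L + n) x powr p)) = \<top>"
  proof (rule ennreal_SUP_eq_top)
    fix n :: nat
    have "real n \<le> (L + Suc n) powr 1"
      using assms by simp
    also have "\<dots> \<le> (L + Suc n) powr p"
      using assms by (intro powr_mono) auto
    finally have "ennreal (real n) \<le> ennreal ((L + Suc n) powr p)"
      by (rule ennreal_leI)
    then show "\<exists>i\<in>UNIV. of_nat n \<le> ennreal (truncated_maximal \<phi> L (L + real i) x powr p)"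
      using 1 assms by (intro bexI[of _ "Suc n"]) (auto simp: truncated_maximal_infinite ennreal_of_nat_eq_real_of_nat)
  qed
  then show ?thesis by (simp only: top_greatest)
next
  case (2 r)
  define n where "n = nat \<lceil>r\<rceil>"
  have "r \<le> real n" unfolding n_def by (rule real_nat_ceiling_ge)
  then have "truncated_maximal \<phi> L (L + n) x = max r L"
    using 2 assms by (auto simp: truncated_maximal_finite)
  moreover have "ennpowr (max (dyadic_maximal M T \<phi> x) (ennreal L)) p = ennreal (max r L powr p)"
    using 2 assms by (auto simp: ennpowr_def max_def)
  ultimately show ?thesis
    by (intro SUP_upper2[of n]) auto
qed

lemma integral_ennpowr_le:
  assumes p: "1 < p" and L: "0 \<le> L" and [measurable]: "\<phi> \<in> borel_measurable M"
    and int: "\<And>N. L \<le> N \<Longrightarrow> integrable M (\<lambda>x. truncated_maximal \<phi> L N x powr p)"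
    and le: "\<And>N. L \<le> N \<Longrightarrow> (\<integral>x. truncated_maximal \<phi> L N x powr p \<partial>M) \<le> V"
  shows "(\<integral>\<^sup>+x. ennpowr (max (dyadic_maximal M T \<phi> x) (ennreal L)) p \<partial>M) \<le> ennreal V"
proof -
  have [measurable]: "truncated_maximal \<phi> L N \<in> borel_measurable M" for N
    unfolding truncated_maximal_def[abs_def] by measurable
  have "(\<integral>\<^sup>+x. ennpowr (max (dyadic_maximal M T \<phi> x) (ennreal L)) p \<partial>M)
      \<le> (\<integral>\<^sup>+x. (SUP n::nat. ennreal (truncated_maximal \<phi> L (L + n) x powr p)) \<partial>M)"
    using p L by (intro nn_integral_mono ennpowr_le_SUP_truncated) auto
  also have "\<dots> = (SUP n::nat. \<integral>\<^sup>+x. ennreal (truncated_maximal \<phi> L (L + n) x powr p) \<partial>M)"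
  proof (rule nn_integral_monotone_convergence_SUP)
    show "incseq (\<lambda>(n::nat) x. ennreal (truncated_maximal \<phi> L (L + n) x powr p))"
    proof (intro monoI le_funI ennreal_leI powr_mono2)
      fix n k :: nat and x assume "n \<le> k"
      then show "truncated_maximal \<phi> L (L + n) x \<le> truncated_maximal \<phi> L (L + k) x"
        by (cases \<phi> x rule: dyadic_maximal_cases)
          (use L in \<open>auto simp: truncated_maximal_infinite truncated_maximal_finite\<close>)
      show "0 \<le> truncated_maximal \<phi> L (L + n) x"
        using truncated_maximal_bounds(1)[of L "L + n" \<phi> x] L by simp
    qed (use p in auto)
  qed measurable
  also have "\<dots> \<le> ennreal V"
    using int le by (intro SUP_least) (auto simp: nn_integral_eq_integral intro!: ennreal_leI)
  finally show ?thesis .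
qed

text \<open>Truncation preserves the weak type bound: for \<open>L \<le> l < N\<close> the
  superlevel sets are those of the maximal function itself, and for \<open>l \<ge> N\<close> they
  are empty.\<close>

lemma admissible_truncated_bounds:
  assumes p: "1 < p" and f: "0 < f" and F: "0 \<le> F" and L: "f \<le> L" "L \<le> N"
    and \<phi>: "\<phi> \<in> bellman_admissible M p f F"
  defines "G \<equiv> (\<integral>x. truncated_maximal \<phi> L N x powr p \<partial>M)"
  shows "integrable M (\<lambda>x. truncated_maximal \<phi> L N x powr p)"
    and "1 < z \<Longrightarrow> (1 - 1 / z) * G
      \<le> L powr p - p / (p - 1) * L powr (p - 1) * f + z powr (p - 1) / (p - 1) * F"
    and "p / (p - 1) * f \<le> L \<Longrightarrow> G \<le> L powr p + (p / (p - 1)) powr p * (F - f powr p)"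
proof -
  have \<phi>_meas[measurable]: "\<phi> \<in> borel_measurable M" and \<phi>_nonneg: "\<And>x. x \<in> space M \<Longrightarrow> 0 \<le> \<phi> x"
    and \<phi>_int: "(\<integral>\<^sup>+x. ennreal (\<phi> x) \<partial>M) = ennreal f" "(\<integral>\<^sup>+x. ennreal (\<phi> x powr p) \<partial>M) = ennreal F"
    using \<phi> by (auto simp: bellman_admissible_def)
  have m_meas: "truncated_maximal \<phi> L N \<in> borel_measurable M"
    unfolding truncated_maximal_def[abs_def] by measurable
  have L0: "0 < L" using f L by simp
  have weak: "ennreal l * emeasure M {x \<in> space M. l < truncated_maximal \<phi> L N x}
      \<le> (\<integral>\<^sup>+x. ennreal (\<phi> x) * indicator {x \<in> space M. l < truncated_maximal \<phi> L N x} x \<partial>M)"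
    if l: "L \<le> l" for l
  proof (cases "l < N")
    case True
    then have "l < truncated_maximal \<phi> L N x \<longleftrightarrow> ennreal l < dyadic_maximal M T \<phi> x" for x
      using less_truncated_maximal_iff[of L N l \<phi> x] l L L0 by simp
    moreover have "(\<integral>\<^sup>+x. ennreal \<bar>\<phi> x\<bar> * indicator {x \<in> space M. ennreal l < dyadic_maximal M T \<phi> x} x \<partial>M)
        = (\<integral>\<^sup>+x. ennreal (\<phi> x) * indicator {x \<in> space M. ennreal l < dyadic_maximal M T \<phi> x} x \<partial>M)"
      using \<phi>_nonneg by (intro nn_integral_cong) simp
    ultimately show ?thesis
      using dyadic_maximal_weak_type[OF \<phi>_meas, of l] by simp
  next
    case False
    then have "\<not> l < truncated_maximal \<phi> L N x" for x
      using truncated_maximal_bounds(2)[of L N \<phi> x] L L0 by simp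
    then show ?thesis by simp
  qed
  have "has_bochner_integral M \<phi> f" "has_bochner_integral M (\<lambda>x. \<phi> x powr p) F"
    using \<phi>_int \<phi>_nonneg f F by (auto intro!: has_bochner_integral_nn_integral AE_I2)
  note bounds = weak_type_imp_integral_le[OF p L0 f m_meas \<phi>_meas
    truncated_maximal_bounds[OF less_imp_le[OF L0] L(2)] \<phi>_nonneg weak this]
  show "integrable M (\<lambda>x. truncated_maximal \<phi> L N x powr p)"
    by (rule bounds(1))
  show "1 < z \<Longrightarrow> (1 - 1 / z) * G
      \<le> L powr p - p / (p - 1) * L powr (p - 1) * f + z powr (p - 1) / (p - 1) * F"
    unfolding G_def by (rule bounds(2))
  show "p / (p - 1) * f \<le> L \<Longrightarrow> G \<le> L powr p + (p / (p - 1)) powr p * (F - f powr p)"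
    unfolding G_def by (rule bounds(3))
qed

section \<open>Upper bounds for the Bellman function\<close>

lemma bellman_le_small_L:
  assumes p: "1 < p" and f: "0 < f" "f \<le> L" and F: "0 < F" and z: "1 < z"
    and Hz: "F * H_fun p z = p * L powr (p - 1) * f - (p - 1) * L powr p"
  shows "bellman M T p f F L \<le> ennreal (F * z powr p)"
  unfolding bellman_def
proof (rule SUP_least)
  fix \<phi> assume \<phi>: "\<phi> \<in> bellman_admissible M p f F"
  show "(\<integral>\<^sup>+x. ennpowr (max (dyadic_maximal M T \<phi> x) (ennreal L)) p \<partial>M) \<le> ennreal (F * z powr p)"
  proof (rule integral_ennpowr_le[OF p])
    fix N assume N: "L \<le> N"
    note bounds = admissible_truncated_bounds[OF p f(1) less_imp_le[OF F] f(2) N \<phi>]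
    show "integrable M (\<lambda>x. truncated_maximal \<phi> L N x powr p)"
      by (rule bounds(1))
    have zz: "z powr p = z powr (p - 1) * z"
      using z by (simp add: powr_diff)
    have "(1 - 1 / z) * (\<integral>x. truncated_maximal \<phi> L N x powr p \<partial>M)
        \<le> L powr p - p / (p - 1) * L powr (p - 1) * f + z powr (p - 1) / (p - 1) * F"
      by (rule bounds(2)[OF z])
    \<comment> \<open>By \<open>Hz\<close> the terms in \<open>L\<close> combine to a multiple of
      \<open>F * H_fun p z\<close>. The factored form of \<open>H_fun\<close> then produces the same
      factor \<open>1 - 1 / z\<close> as on the left, and it cancels since
      \<open>z > 1\<close>.\<close>
    also have "\<dots> = - (F * H_fun p z) / (p - 1) + z powr (p - 1) / (p - 1) * F"
      unfolding Hz using p by (simp add: field_simps)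
    also have "\<dots> = (1 - 1 / z) * (F * z powr p)"
    proof -
      have "- (F * H_fun p z) + z powr (p - 1) * F = (p - 1) * (F * z powr (p - 1) * (z - 1))"
        using z by (simp add: H_fun_factored algebra_simps)
      moreover have "- (F * H_fun p z) / (p - 1) + z powr (p - 1) / (p - 1) * F
          = (- (F * H_fun p z) + z powr (p - 1) * F) / (p - 1)"
        by (simp add: diff_divide_distrib)
      ultimately have "- (F * H_fun p z) / (p - 1) + z powr (p - 1) / (p - 1) * F = F * z powr (p - 1) * (z - 1)"
        using p by simp
      also have "\<dots> = (1 - 1 / z) * (F * z powr p)"
        unfolding zz using z by (simp add: field_simps)
      finally show ?thesis .
    qed
    finally show "(\<integral>x. truncated_maximal \<phi> L N x powr p \<partial>M) \<le> F * z powr p"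
      using z by simp
  qed (use f \<phi> in \<open>auto simp: bellman_admissible_def\<close>)
qed

lemma bellman_le_large_L:
  assumes p: "1 < p" and f: "0 < f" and F: "0 \<le> F" and L: "p / (p - 1) * f \<le> L"
  shows "bellman M T p f F L \<le> ennreal (L powr p + (p / (p - 1)) powr p * (F - f powr p))"
  unfolding bellman_def
proof (rule SUP_least)
  fix \<phi> assume \<phi>: "\<phi> \<in> bellman_admissible M p f F"
  have "1 * f \<le> p / (p - 1) * f"
    using p f by (intro mult_right_mono) auto
  with L have fL: "f \<le> L" by simp
  show "(\<integral>\<^sup>+x. ennpowr (max (dyadic_maximal M T \<phi> x) (ennreal L)) p \<partial>M)
      \<le> ennreal (L powr p + (p / (p - 1)) powr p * (F - f powr p))"
  proof (rule integral_ennpowr_le[OF p])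
    fix N assume N: "L \<le> N"
    note bounds = admissible_truncated_bounds[OF p f F fL N \<phi>]
    show "integrable M (\<lambda>x. truncated_maximal \<phi> L N x powr p)"
      by (rule bounds(1))
    show "(\<integral>x. truncated_maximal \<phi> L N x powr p \<partial>M) \<le> L powr p + (p / (p - 1)) powr p * (F - f powr p)"
      by (rule bounds(3)[OF L])
  qed (use f fL \<phi> in \<open>auto simp: bellman_admissible_def\<close>)
qed

section \<open>Monotonicity in \<open>L\<close>, the minimal value of \<open>F\<close>, and the
  formula\<close>

lemma bellman_mono_L:
  assumes "0 \<le> L" "L \<le> L'" "0 \<le> p"
  shows "bellman M T p f F L \<le> bellman M T p f F L'"
proof -
  have "ennpowr (max x (ennreal L)) p \<le> ennpowr (max x (ennreal L')) p" for x
  proof (cases x)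
    case (real r)
    then have "max x (ennreal L) = ennreal (max r L)" "max x (ennreal L') = ennreal (max r L')"
      using assms by (auto simp: max_def)
    then show ?thesis
      using assms real by (auto simp: ennpowr_def intro!: ennreal_leI powr_mono2)
  qed (simp add: ennpowr_def)
  then show ?thesis
    unfolding bellman_def by (intro SUP_mono) (blast intro: nn_integral_mono)
qed

text \<open>The upper bound wants \<open>z = L / f\<close>, but \<open>bellman_le_small_L\<close>
  requires \<open>z > 1\<close>, which fails for \<open>L = f\<close>. So it is applied at
  \<open>K > L\<close> with \<open>z = K / f\<close>, giving \<open>K powr p\<close>, and
  \<open>K\<close> decreases to \<open>L\<close>.\<close>

lemma bellman_small_L_minimal_F:
  assumes p: "1 < p" and f: "0 < f" "f \<le> L"
  shows "bellman M T p f (f powr p) L = ennreal (L powr p)"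
proof (rule antisym)
  have le: "bellman M T p f (f powr p) L \<le> ennreal (K powr p)" if K: "L < K" for K
  proof -
    have "f powr p * H_fun p (K / f) = p * K powr (p - 1) * f - (p - 1) * K powr p"
      using f K by (intro H_fun_ratio) auto
    then have "bellman M T p f (f powr p) K \<le> ennreal (f powr p * (K / f) powr p)"
      using p f K by (intro bellman_le_small_L) auto
    also have "f powr p * (K / f) powr p = K powr p"
      using f K by (simp add: powr_divide)
    finally show ?thesis
      using bellman_mono_L[of L K p f "f powr p"] p f K by (auto intro: order_trans)
  qed
  have "((\<lambda>K. ennreal (K powr p)) \<longlongrightarrow> ennreal (L powr p)) (at_right L)"
    using f by (intro tendsto_ennrealI tendsto_intros tendsto_ident_at) auto
  moreover have "\<forall>\<^sub>F K in at_right L. L < K"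
    by (rule eventually_at_right_less)
  then have "\<forall>\<^sub>F K in at_right L. bellman M T p f (f powr p) L \<le> ennreal (K powr p)"
    by (rule eventually_mono) (rule le)
  ultimately show "bellman M T p f (f powr p) L \<le> ennreal (L powr p)"
    by (rule tendsto_lowerbound) simp
  show "ennreal (L powr p) \<le> bellman M T p f (f powr p) L"
    by (rule bellman_ge_trivial[OF p f])
qed

text \<open>The case \<open>F = f powr p\<close> is separate because both constructions for the
  lower bound need a strict inequality. There the value is \<open>L powr p\<close>, and both
  branches reduce to it, the first because \<open>omega_fun\<close> inverts \<open>H_fun\<close> at
  \<open>L / f\<close>.\<close>

lemma bellman_eq:
  assumes p: "1 < p" and f: "0 < f" and F: "f powr p \<le> F" and L: "f \<le> L"
  shows "bellman M T p f F L =
    ennreal (if L < p / (p - 1) * f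
             then F * omega_fun p ((p * L powr (p - 1) * f - (p - 1) * L powr p) / F) powr p
             else L powr p + (p / (p - 1)) powr p * (F - f powr p))"
proof -
  define y where "y = (p * L powr (p - 1) * f - (p - 1) * L powr p) / F"
  have F0: "0 < F" using f F by (auto intro: less_le_trans[of 0 "f powr p"])
  have L0: "0 < L" using f L by simp
  have Lf: "1 \<le> L / f" using f L by simp
  have Fy: "F * y = f powr p * H_fun p (L / f)"
    unfolding H_fun_ratio[OF f L0] using F0 by (simp add: y_def)
  consider (min) "F = f powr p" | (large) "f powr p < F" "p / (p - 1) * f \<le> L"
    | (small) "f powr p < F" "L < p / (p - 1) * f"
    using F by linarith
  then show ?thesis
  proof cases
    case min
    have val: "F * omega_fun p y powr p = L powr p" if "L < p / (p - 1) * f"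
    proof -
      have "y = H_fun p (L / f)" using Fy F0 min by simp
      moreover have "L / f \<le> p / (p - 1)" using that f by (simp add: field_simps)
      ultimately have "omega_fun p y = L / f"
        using omega_fun_H_fun[OF p Lf] by simp
      then show ?thesis using f L0 by (simp add: min powr_divide)
    qed
    have "bellman M T p f F L = ennreal (L powr p)"
      unfolding min by (rule bellman_small_L_minimal_F[OF p f L])
    then show ?thesis
      unfolding y_def[symmetric] using val min
      by (cases "L < p / (p - 1) * f") (simp_all only: if_True if_False, simp)
  next
    case large
    then show ?thesis
      using bellman_ge_large_L[OF p f] bellman_le_large_L[OF p f, of F L] F0 by (simp add: antisym)
  next
    case small
    have "L / f < p / (p - 1)" using small(2) f by (simp add: field_simps)
    then have H: "0 < H_fun p (L / f)" by (rule H_fun_pos[OF p Lf])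
    have H1: "H_fun p (L / f) \<le> 1"
      using H_fun_less_iff[OF p order_refl Lf] Lf by (auto simp: not_less[symmetric])
    have y0: "0 < y"
      using Fy F0 H f by (metis mult_pos_pos powr_gt_zero zero_less_mult_pos less_irrefl)
    have "f powr p * H_fun p (L / f) \<le> f powr p * 1"
      using H1 by (intro mult_left_mono) auto
    then have "F * y < F * 1" using Fy small(1) by simp
    then have y1: "y < 1" using F0 by simp
    define z where "z = omega_fun p y"
    have z: "1 \<le> z" "z \<le> p / (p - 1)" "H_fun p z = y"
      using omega_fun_inverse[of p y] p y0 y1 by (auto simp: z_def)
    \<comment> \<open>At these endpoints \<open>H_fun\<close> takes the values 1 and 0, whereas
      \<open>0 < y < 1\<close>. The matching bounds apply only to \<open>z\<close> strictly between
      them.\<close>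
    have "z \<noteq> 1" "z \<noteq> p / (p - 1)"
      using z(3) y0 y1 H_fun_conjugate[OF p] by auto
    with z have z': "1 < z" "z < p / (p - 1)" by auto
    have Hz: "F * H_fun p z = p * L powr (p - 1) * f - (p - 1) * L powr p"
      using F0 by (simp add: z(3) y_def)
    have "bellman M T p f F L = ennreal (F * z powr p)"
      by (intro antisym bellman_le_small_L[OF p f L F0 z'(1) Hz] bellman_ge_small_L[OF p f L z' small(1) Hz])
    then show ?thesis
      using small(2) by (simp add: z_def y_def)
  qed
qed

end

theorem mainTheorem2:
  fixes M :: "'a measure" and T :: "'a set set" and p f F L :: real
  assumes "prob_space M" and "nonatomic M" and "is_tree M T"
    and "1 < p" and "0 < f" and "f powr p \<le> F" and "f \<le> L"
  shows "bellman M T p f F L =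
    ennreal (if L < p / (p - 1) * f
             then F * omega_fun p ((p * L powr (p - 1) * f - (p - 1) * L powr p) / F) powr p
             else L powr p + (p / (p - 1)) powr p * (F - f powr p))"
proof -
  interpret prob_space M by fact
  from \<open>is_tree M T\<close> obtain C where C: "\<forall>I\<in>T. C I \<subseteq> T \<and> countable (C I) \<and>
      (\<exists>J\<in>C I. \<exists>K\<in>C I. J \<noteq> K) \<and> disjoint (C I) \<and> (\<forall>J\<in>C I. J \<subseteq> I) \<and> I = \<Union>(C I)"
    "T = (\<Union>m. tree_level (space M) C m)"
    "(\<lambda>m. SUP I\<in>tree_level (space M) C m. emeasure M I) \<longlonglongrightarrow> 0"
    unfolding is_tree_def by blast
  interpret tree_prob_space M T C
  proof
    show "T \<subseteq> sets M" "space M \<in> T" and "\<And>I. I \<in> T \<Longrightarrow> 0 < emeasure M I"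
      using \<open>is_tree M T\<close> by (simp_all add: is_tree_def)
  qed (use C in blast)+
  show ?thesis
    using assms(4-7) by (rule bellman_eq)
qed

end
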